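(* Let $d\geq 4$, let $\mathbb{X}^d=\mathbb{R}^d$ or $\mathbb{X}^d=\mathbb{C}^d$, let $\{b_1,\ldots,b_d\}$ be a random orthonormal basis of $\mathbb{X}^d$ with distribution $u_{ONB(\mathbb{X}^d)}$, and let $\varphi\in L^2(\mathbb{S}(\mathbb{X}^d),u,\mathbb{R})$. Then $$\Bigl|\operatorname{Cov}\bigl(\varphi(b_1),\varphi(b_2)\bigr)\Bigr|\leq\frac{1}{d-1}\operatorname{Var}_u(\varphi).$$ The estimate is sharp in the sense that for every such $d$ there exists a $\varphi$ for which equality holds.
   Context: $\mathbb{S}(\mathbb{X}^d)$ is the unit sphere of $\mathbb{X}^d$ (with its standard inner product); $u$ is the uniform probability measure (normalized surface area) on $\mathbb{S}(\mathbb{X}^d)$; $L^2(\mathbb{S}(\mathbb{X}^d),u,\mathbb{R})$ is the space of real-valued square-integrable functions with respect to $u$; $\operatorname{Var}_u(\varphi)$ is the variance of $\varphi$ with respect to $u$; $\operatorname{Cov}$ is the covariance of random variables. $G$ is the orthogonal group $O(d)$ if $\mathbb{X}^d=\mathbb{R}^d$ and the unitary group $U(d)$ if $\mathbb{X}^d=\mathbb{C}^d$. The uniform distribution $u_{ONB(\mathbb{X}^d)}$ over (ordered) orthonormal bases of $\mathbb{X}^d$ is the distribution of $(R(e_1),\ldots,R(e_d))$, where $(e_1,\ldots,e_d)$ is any fixed orthonormal basis and $R$ is a random element of $G$ distributed according to normalized Haar measure; it does not depend on the choice of the fixed basis. *)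

theory Defs
  imports "HOL-Probability.Probability"
begin

text \<open>
  Surface area of the unit sphere in polar coordinates: a Borel subset \<open>E\<close> of the sphere has
  area \<open>DIM('a)\<close> times the volume of the punctured cone \<open>{r *\<^sub>R x | r x. 0 < r \<and> r \<le> 1 \<and> x \<in> E}\<close>,
  which is the preimage of \<open>E\<close> under \<open>sgn x = x /\<^sub>R norm x\<close> in the punctured unit ball. On
  \<open>complex ^ 'n\<close> the Lebesgue measure and the norm are those of the underlying real space of
  dimension \<open>2 * CARD('n)\<close>; this norm is the one of the Hermitian inner product.
\<close>

definition sphere_area :: "'a::euclidean_space measure" where
  "sphere_area = scale_measure (of_nat DIM('a))
     (distr (restrict_space lborel (cball 0 1 - {0})) (restrict_space borel (sphere 0 1)) sgn)"

definition uniform_sphere :: "'a::euclidean_space measure" where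
  "uniform_sphere = uniform_measure sphere_area (sphere 0 1)"

text \<open>
  Square-integrable functions are represented by functions, not by classes modulo null sets;
  the values outside \<open>space M\<close> are irrelevant.
\<close>

definition L2_real :: "'a measure \<Rightarrow> ('a \<Rightarrow> real) set" where
  "L2_real M = {f \<in> borel_measurable M. integrable M (\<lambda>x. (f x)\<^sup>2)}"

definition covariance :: "'a measure \<Rightarrow> ('a \<Rightarrow> real) \<Rightarrow> ('a \<Rightarrow> real) \<Rightarrow> real" where
  "covariance M X Y =
     (LINT \<omega>|M. (X \<omega> - (LINT \<omega>'|M. X \<omega>')) * (Y \<omega> - (LINT \<omega>'|M. Y \<omega>')))"

definition cinner_vec :: "complex ^ 'n \<Rightarrow> complex ^ 'n \<Rightarrow> complex" where
  "cinner_vec x y = (\<Sum>k\<in>UNIV. cnj (x $ k) * y $ k)"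

definition adjoint_matrix :: "complex ^ 'n ^ 'm \<Rightarrow> complex ^ 'm ^ 'n" where
  "adjoint_matrix A = (\<chi> i j. cnj (A $ j $ i))"

definition unitary_matrix :: "complex ^ 'n ^ 'n \<Rightarrow> bool" where
  "unitary_matrix A \<longleftrightarrow> adjoint_matrix A ** A = mat 1 \<and> A ** adjoint_matrix A = mat 1"

definition orthogonal_group :: "(real ^ 'n ^ 'n) set" where
  "orthogonal_group = {A. orthogonal_matrix A}"

definition unitary_group :: "(complex ^ 'n ^ 'n) set" where
  "unitary_group = {A. unitary_matrix A}"

text \<open>
  For a compact matrix group \<open>G\<close> there is exactly one such measure.
\<close>

definition normalized_haar ::
    "(('a::{semiring_1,topological_space}) ^ 'n ^ 'n) set \<Rightarrow> ('a ^ 'n ^ 'n) measure \<Rightarrow> bool" where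
  "normalized_haar G \<mu> \<longleftrightarrow>
     sets \<mu> = sets (restrict_space borel G) \<and> prob_space \<mu> \<and>
     (\<forall>g\<in>G. \<forall>A\<in>sets \<mu>. emeasure \<mu> ((\<lambda>x. g ** x) ` A) = emeasure \<mu> A)"

text \<open>
  An ordered family \<open>b\<close> of vectors of \<open>'a ^ 'n\<close> indexed by \<open>'n\<close> is a vector of vectors, its
  \<open>i\<close>-th member being \<open>b $ i\<close>. Since the family has as many members as the dimension, it is a
  basis as soon as it is orthonormal. The parameter \<open>ip\<close> is the inner product.
\<close>

definition onb :: "('a ^ 'n \<Rightarrow> 'a ^ 'n \<Rightarrow> 'a::semiring_1) \<Rightarrow> ('a ^ 'n ^ 'n) set" where
  "onb ip = {b. \<forall>i j. ip (b $ i) (b $ j) = (if i = j then 1 else 0)}"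

definition onb_space ::
    "('a ^ 'n \<Rightarrow> 'a ^ 'n \<Rightarrow> 'a::{semiring_1,topological_space}) \<Rightarrow> ('a ^ 'n ^ 'n) measure" where
  "onb_space ip = restrict_space borel (onb ip)"

definition uniform_random_onb ::
    "('a ^ 'n \<Rightarrow> 'a ^ 'n \<Rightarrow> 'a::{semiring_1,topological_space}) \<Rightarrow> ('a ^ 'n ^ 'n) set \<Rightarrow>
     'w measure \<Rightarrow> ('w \<Rightarrow> 'a ^ 'n ^ 'n) \<Rightarrow> bool" where
  "uniform_random_onb ip G M b \<longleftrightarrow>
     prob_space M \<and> b \<in> measurable M (onb_space ip) \<and>
     (\<exists>\<mu>. normalized_haar G \<mu> \<and>
        distr M (onb_space ip) b = distr \<mu> (onb_space ip) (\<lambda>R. \<chi> i. R *v axis i 1))"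

end

theory Submission
  imports Defs "HOL-Library.Function_Algebras"
begin

text \<open>
  Write \<open>b\<^sub>k = R e\<^sub>k\<close> with \<open>R\<close> Haar distributed. The bilinear form \<open>E (f (b\<^sub>i) g (b\<^sub>j))\<close> is
  \<open>\<langle>T f, g\<rangle>\<close> for a self-adjoint operator \<open>T\<close> on \<open>L\<^sup>2\<close>: \<open>T f (y)\<close> is the mean of \<open>f\<close> over the unit
  vectors orthogonal to \<open>y\<close>. For \<open>f x = \<bar>\<langle>a, x\<rangle>\<bar> ^ (2 l)\<close>, invariance gives
  \<open>T f (y) = c\<^sub>l (\<bar>a\<bar>\<^sup>2 - \<bar>\<langle>a, y\<rangle>\<bar>\<^sup>2) ^ l\<close>, where \<open>c\<^sub>l\<close> is the mean of \<open>\<bar>x\<^sub>1\<bar> ^ (2 l)\<close> over a unit sphere one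
  dimension lower. So \<open>T\<close> is triangular on the span of these functions, with diagonal entries
  \<open>(- 1) ^ l c\<^sub>l\<close>, and \<open>\<bar>x\<^sub>1\<bar> ^ (2 l) + \<bar>x\<^sub>2\<bar> ^ (2 l) + \<dots> \<le> 1\<close> shows \<open>c\<^sub>l \<le> 1 / (d - 1)\<close> for \<open>l \<ge> 1\<close>. Being
  self-adjoint, \<open>T\<close> is diagonal after orthogonalization. It maps the powers of
  \<open>Re \<langle>a, x\<rangle>\<close>, whose span is dense in \<open>L\<^sup>2\<close>, into this span. Equality holds for \<open>l = 1\<close>.
\<close>

section \<open>Symmetric forms on real vector spaces\<close>

lemma span_insert_residualE:
  fixes f :: "'v::real_vector"
  assumes "w \<in> span (insert f W)" "subspace W" "p \<in> W"
  obtains s c where "s \<in> W" "w = s + c *\<^sub>R (f - p)"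
proof -
  obtain c where "w - c *\<^sub>R f \<in> W"
    using assms(1,2) by (auto simp: span_breakdown_eq span_eq_iff[THEN iffD2])
  then have "(w - c *\<^sub>R f) + c *\<^sub>R p \<in> W"
    using assms(2,3) by (intro subspace_add subspace_scale)
  then show thesis by (rule that[of _ c]) (simp add: algebra_simps)
qed

locale symmetric_form =
  fixes F :: "'v::real_vector set" and B :: "'v \<Rightarrow> 'v \<Rightarrow> real"
  assumes subspace: "subspace F"
    and add_left: "f \<in> F \<Longrightarrow> g \<in> F \<Longrightarrow> h \<in> F \<Longrightarrow> B (f + g) h = B f h + B g h"
    and scaleR_left: "f \<in> F \<Longrightarrow> h \<in> F \<Longrightarrow> B (c *\<^sub>R f) h = c * B f h"
    and commute: "f \<in> F \<Longrightarrow> g \<in> F \<Longrightarrow> B f g = B g f"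
begin

lemmas zero_mem = subspace_0[OF subspace]
lemmas add_mem = subspace_add[OF subspace]
lemmas diff_mem = subspace_diff[OF subspace]
lemmas scaleR_mem = subspace_scale[OF subspace]
lemmas carrier_closed = zero_mem add_mem diff_mem scaleR_mem

lemma add_right: "f \<in> F \<Longrightarrow> g \<in> F \<Longrightarrow> h \<in> F \<Longrightarrow> B h (f + g) = B h f + B h g"
  by (simp add: commute[of h] add_left carrier_closed)

lemma scaleR_right: "f \<in> F \<Longrightarrow> h \<in> F \<Longrightarrow> B h (c *\<^sub>R f) = c * B h f"
  by (simp add: commute[of h] scaleR_left carrier_closed)

lemma diff_left: "f \<in> F \<Longrightarrow> g \<in> F \<Longrightarrow> h \<in> F \<Longrightarrow> B (f - g) h = B f h - B g h"
  using add_left[of f "(-1) *\<^sub>R g" h] scaleR_left[of g h "-1"] scaleR_mem[of g "-1"] by simp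

lemma diff_right: "f \<in> F \<Longrightarrow> g \<in> F \<Longrightarrow> h \<in> F \<Longrightarrow> B h (f - g) = B h f - B h g"
  by (simp add: commute[of h] diff_left carrier_closed)

lemma zero_left: "f \<in> F \<Longrightarrow> B 0 f = 0"
  using scaleR_left[of 0 f 0] zero_mem by simp

lemma zero_right: "f \<in> F \<Longrightarrow> B f 0 = 0"
  using commute[of f 0] zero_left[of f] zero_mem by simp

lemmas bilinear = add_left add_right scaleR_left scaleR_right diff_left diff_right

end

lemma symmetric_form_linear_combination:
  assumes "symmetric_form F B" "symmetric_form F C"
  shows "symmetric_form F (\<lambda>f g. s * B f g + t * C f g)"
proof -
  interpret B: symmetric_form F B by fact
  interpret C: symmetric_form F C by fact
  show ?thesis
    by unfold_locales
      (simp_all add: B.subspace B.bilinear C.bilinear B.commute C.commute algebra_simps)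
qed

lemma symmetric_form_rank_one:
  fixes l :: "'v::real_vector \<Rightarrow> real"
  assumes "subspace F" "\<And>f g. f \<in> F \<Longrightarrow> g \<in> F \<Longrightarrow> l (f + g) = l f + l g"
    "\<And>c f. f \<in> F \<Longrightarrow> l (c *\<^sub>R f) = c * l f"
  shows "symmetric_form F (\<lambda>f g. l f * l g)"
  by unfold_locales (simp_all add: assms algebra_simps)

locale semidefinite_form = symmetric_form F C
  for F :: "'v::real_vector set" and C +
  assumes nonneg: "f \<in> F \<Longrightarrow> C f f \<ge> 0"
begin

lemma Cauchy_Schwarz:
  assumes f: "f \<in> F" and g: "g \<in> F"
  shows "(C f g)\<^sup>2 \<le> C f f * C g g"
proof (cases "C g g = 0")
  case True
  have "0 \<le> C f f + 2 * c * C f g" for c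
    using nonneg[of "f + c *\<^sub>R g"] f g True by (simp add: bilinear carrier_closed commute[of g f])
  from this[of "- (C f f + 1) / (2 * C f g)"] show ?thesis
    using True by (cases "C f g = 0") (auto simp: field_simps)
next
  case False
  have "0 \<le> C g g * (C f f * C g g - (C f g)\<^sup>2)"
    using nonneg[of "C g g *\<^sub>R f - C f g *\<^sub>R g"] f g
    by (simp add: bilinear carrier_closed commute[of g f] power2_eq_square algebra_simps)
  then show ?thesis using False nonneg[OF g] by (simp add: zero_le_mult_iff)
qed

definition seminorm :: "'v \<Rightarrow> real" where
  "seminorm f = sqrt (C f f)"

lemma seminorm_nonneg: "f \<in> F \<Longrightarrow> seminorm f \<ge> 0"
  by (simp add: seminorm_def nonneg)

lemma seminorm_square: "f \<in> F \<Longrightarrow> (seminorm f)\<^sup>2 = C f f"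
  by (simp add: seminorm_def nonneg)

lemma abs_form_le_seminorm: "f \<in> F \<Longrightarrow> g \<in> F \<Longrightarrow> \<bar>C f g\<bar> \<le> seminorm f * seminorm g"
  using real_sqrt_le_mono[OF Cauchy_Schwarz] by (simp add: seminorm_def real_sqrt_mult)

lemma form_null: "f \<in> F \<Longrightarrow> g \<in> F \<Longrightarrow> C g g = 0 \<Longrightarrow> C f g = 0"
  using Cauchy_Schwarz[of f g] by simp

lemma seminorm_triangle:
  assumes f: "f \<in> F" and g: "g \<in> F"
  shows "seminorm (f + g) \<le> seminorm f + seminorm g"
proof (rule power2_le_imp_le)
  show "(seminorm (f + g))\<^sup>2 \<le> (seminorm f + seminorm g)\<^sup>2"
    using abs_form_le_seminorm[OF f g] f g
    by (simp add: power2_sum seminorm_square bilinear carrier_closed commute[of g f])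
qed (simp add: seminorm_nonneg f g)

lemma seminorm_scaleR: "f \<in> F \<Longrightarrow> seminorm (c *\<^sub>R f) = \<bar>c\<bar> * seminorm f"
  by (simp add: seminorm_def bilinear carrier_closed real_sqrt_mult flip: mult.assoc)

lemma seminorm_zero: "seminorm 0 = 0"
  by (simp add: seminorm_def zero_left carrier_closed)

definition form_closure :: "'v set \<Rightarrow> 'v set" where
  "form_closure P = {f \<in> F. \<forall>e>0. \<exists>p\<in>P. seminorm (f - p) < e}"

lemma form_closure_subset: "form_closure P \<subseteq> F"
  by (auto simp: form_closure_def)

lemma form_closure_superset: "P \<subseteq> F \<Longrightarrow> P \<subseteq> form_closure P"
  by (auto simp: form_closure_def seminorm_zero intro!: bexI)

lemma form_closureD:
  assumes "f \<in> form_closure P" "e > 0"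
  obtains p where "p \<in> P" "seminorm (f - p) < e"
  using assms by (auto simp: form_closure_def)

lemma form_closure_idem:
  assumes P: "P \<subseteq> F" and f: "f \<in> form_closure (form_closure P)"
  shows "f \<in> form_closure P"
  unfolding form_closure_def
proof safe
  show F: "f \<in> F" using f form_closure_subset by blast
  fix e :: real assume "e > 0"
  then have "e / 2 > 0" by simp
  with f obtain g where g: "g \<in> form_closure P" "seminorm (f - g) < e / 2" by (rule form_closureD)
  obtain p where p: "p \<in> P" "seminorm (g - p) < e / 2"
    using g(1) \<open>e / 2 > 0\<close> by (rule form_closureD)
  have "seminorm ((f - g) + (g - p)) \<le> seminorm (f - g) + seminorm (g - p)"
    using F g(1) p(1) P form_closure_subset by (intro seminorm_triangle diff_mem) auto
  then have "seminorm (f - p) < e" using g(2) p(2) by simp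
  then show "\<exists>p\<in>P. seminorm (f - p) < e" using p(1) by blast
qed

lemma form_closure_add:
  assumes P: "subspace P" "P \<subseteq> F" and f: "f \<in> form_closure P" and g: "g \<in> form_closure P"
  shows "f + g \<in> form_closure P"
  unfolding form_closure_def
proof safe
  have F: "f \<in> F" "g \<in> F" using f g form_closure_subset by auto
  then show "f + g \<in> F" by (rule add_mem)
  fix e :: real assume "e > 0"
  then have "e / 2 > 0" by simp
  obtain p where p: "p \<in> P" "seminorm (f - p) < e / 2" using f \<open>e / 2 > 0\<close> by (rule form_closureD)
  obtain q where q: "q \<in> P" "seminorm (g - q) < e / 2" using g \<open>e / 2 > 0\<close> by (rule form_closureD)
  have "seminorm ((f - p) + (g - q)) \<le> seminorm (f - p) + seminorm (g - q)"
    using F p(1) q(1) P(2) by (intro seminorm_triangle diff_mem) auto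
  also have "(f - p) + (g - q) = f + g - (p + q)" by simp
  finally show "\<exists>r\<in>P. seminorm (f + g - r) < e"
    using p(2) q(2) by (intro bexI[OF _ subspace_add[OF P(1) p(1) q(1)]]) linarith
qed

lemma form_closure_scaleR:
  assumes P: "subspace P" "P \<subseteq> F" and f: "f \<in> form_closure P"
  shows "c *\<^sub>R f \<in> form_closure P"
  unfolding form_closure_def
proof safe
  have F: "f \<in> F" using f form_closure_subset by auto
  then show "c *\<^sub>R f \<in> F" by (rule scaleR_mem)
  fix e :: real assume "e > 0"
  then have "e / (\<bar>c\<bar> + 1) > 0" by (simp add: add_nonneg_pos)
  with f obtain p where p: "p \<in> P" "seminorm (f - p) < e / (\<bar>c\<bar> + 1)" by (rule form_closureD)
  have fp: "f - p \<in> F" using F p(1) P(2) by (intro diff_mem) auto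
  have "seminorm (c *\<^sub>R f - c *\<^sub>R p) = \<bar>c\<bar> * seminorm (f - p)"
    by (simp add: seminorm_scaleR[OF fp] flip: scaleR_diff_right)
  also have "\<dots> \<le> (\<bar>c\<bar> + 1) * seminorm (f - p)"
    by (intro mult_right_mono seminorm_nonneg fp) simp
  also have "\<dots> < e" using p(2) by (simp add: pos_less_divide_eq add_nonneg_pos mult.commute)
  finally show "\<exists>r\<in>P. seminorm (c *\<^sub>R f - r) < e"
    by (intro bexI[OF _ subspace_scale[OF P(1) p(1)]])
qed

lemma subspace_form_closure:
  assumes P: "subspace P" "P \<subseteq> F"
  shows "subspace (form_closure P)"
  using subspace_0[OF P(1)] form_closure_superset[OF P(2)]
  by (intro subspaceI form_closure_add[OF P] form_closure_scaleR[OF P]) auto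

lemma nonneg_on_form_closure:
  assumes "symmetric_form F D"
    and bounded: "\<And>f g. f \<in> F \<Longrightarrow> g \<in> F \<Longrightarrow> \<bar>D f g\<bar> \<le> K * (seminorm f * seminorm g)"
    and P: "P \<subseteq> F" "\<And>p. p \<in> P \<Longrightarrow> D p p \<ge> 0"
    and f: "f \<in> form_closure P"
  shows "D f f \<ge> 0"
proof -
  interpret D: symmetric_form F D by fact
  have "f \<in> F" using f form_closure_subset by blast
  have lower: "- (\<bar>K\<bar> * e * (2 * seminorm f + e)) \<le> D f f" if "e > 0" for e
  proof -
    obtain p where p: "p \<in> P" "seminorm (f - p) < e" using f \<open>e > 0\<close> by (rule form_closureD)
    define d where "d = f - p"
    have d: "d \<in> F" using \<open>f \<in> F\<close> p(1) P(1) by (auto simp: d_def carrier_closed)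
    have "D (f - d) (f - d) \<ge> 0" using P(2)[OF p(1)] by (simp add: d_def)
    then have "- (2 * \<bar>D d f\<bar> + \<bar>D d d\<bar>) \<le> D f f"
      using \<open>f \<in> F\<close> d by (simp add: D.bilinear carrier_closed D.commute[of f d])
    moreover have "\<bar>D d g\<bar> \<le> \<bar>K\<bar> * (e * seminorm g)" if "g \<in> F" for g
    proof -
      have "\<bar>D d g\<bar> \<le> K * (seminorm d * seminorm g)" by (rule bounded[OF d that])
      also have "\<dots> \<le> \<bar>K\<bar> * (e * seminorm g)"
        using p(2) \<open>e > 0\<close> by (intro mult_mono) (auto simp: seminorm_nonneg that d simp flip: d_def)
      finally show ?thesis .
    qed
    from this[OF \<open>f \<in> F\<close>] this[OF d]
    have "2 * \<bar>D d f\<bar> + \<bar>D d d\<bar> \<le> \<bar>K\<bar> * e * (2 * seminorm f + seminorm d)"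
      by (simp add: algebra_simps)
    moreover have "\<bar>K\<bar> * e * (2 * seminorm f + seminorm d) \<le> \<bar>K\<bar> * e * (2 * seminorm f + e)"
      using p(2) \<open>e > 0\<close> by (intro mult_left_mono) (auto simp: d_def)
    ultimately show ?thesis by linarith
  qed
  show ?thesis
  proof (rule tendsto_upperbound)
    show "((\<lambda>e. - (\<bar>K\<bar> * e * (2 * seminorm f + e))) \<longlongrightarrow> 0) (at_right 0)"
      by (rule tendsto_eq_intros refl | simp)+
    show "\<forall>\<^sub>F e in at_right 0. - (\<bar>K\<bar> * e * (2 * seminorm f + e)) \<le> D f f"
      using eventually_at_right_less by (rule eventually_mono) (rule lower)
  qed simp
qed

end

locale form_pair = semidefinite_form F C + B: symmetric_form F B
  for F :: "'v::real_vector set" and C B +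
  fixes \<kappa> :: real
begin

definition represents :: "'v \<Rightarrow> 'v \<Rightarrow> bool" where
  "represents h f \<longleftrightarrow> f \<in> F \<and> h \<in> F \<and> (\<forall>g\<in>F. B f g = C h g)"

lemma representsD:
  assumes "represents h f"
  shows "f \<in> F" "h \<in> F" "g \<in> F \<Longrightarrow> B f g = C h g"
  using assms by (auto simp: represents_def)

lemma represents_zero: "represents 0 0"
  by (simp add: represents_def zero_left B.zero_left carrier_closed)

lemma represents_add: "represents h f \<Longrightarrow> represents h' f' \<Longrightarrow> represents (h + h') (f + f')"
  by (simp add: represents_def bilinear B.bilinear carrier_closed)

lemma represents_diff: "represents h f \<Longrightarrow> represents h' f' \<Longrightarrow> represents (h - h') (f - f')"
  by (simp add: represents_def bilinear B.bilinear carrier_closed)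

lemma represents_scaleR: "represents h f \<Longrightarrow> represents (c *\<^sub>R h) (c *\<^sub>R f)"
  by (simp add: represents_def bilinear B.bilinear carrier_closed)

text \<open>
  Think of \<open>represents h f\<close> as \<open>T f = h\<close>. On the spaces \<open>W\<close> with \<open>triangular W\<close> the operator \<open>T\<close> is
  triangular with diagonal entries bounded by \<open>\<kappa>\<close>. The residual of a new generator after projection to
  the previous space is orthogonal to it for both forms, because \<open>T\<close> is symmetric.
\<close>

inductive triangular :: "'v set \<Rightarrow> bool" where
  zero: "triangular {0}"
| insert: "triangular W \<Longrightarrow> r \<in> W \<Longrightarrow> \<bar>l\<bar> \<le> \<kappa> \<Longrightarrow> represents (l *\<^sub>R f + r) f \<Longrightarrow>
    triangular (span (insert f W))"

lemma triangular_subspace: "triangular W \<Longrightarrow> subspace W"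
  by (induction rule: triangular.induct) simp_all

lemma triangular_subset: "triangular W \<Longrightarrow> W \<subseteq> F"
proof (induction rule: triangular.induct)
  case (insert W r l f)
  then have "insert f W \<subseteq> F" by (simp add: representsD(1))
  then show ?case using subspace by (rule span_minimal)
qed (simp add: carrier_closed)

lemma triangular_extend:
  assumes "triangular W" "r \<in> W" "\<bar>l\<bar> \<le> \<kappa>" "represents (l *\<^sub>R f + r) f"
  shows "\<exists>W'. triangular W' \<and> W \<subseteq> W' \<and> f \<in> W'"
  using triangular.insert[OF assms] span_superset[of "insert f W"] by blast

lemma triangular_represents:
  assumes "triangular W" "s \<in> W"
  shows "\<exists>r\<in>W. represents r s"
  using assms
proof (induction arbitrary: s rule: triangular.induct)
  case zero
  then show ?case by (simp add: represents_zero)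
next
  case (insert W r l f)
  obtain w c where s: "w \<in> W" "s = w + c *\<^sub>R f"
    using span_insert_residualE[OF insert.prems triangular_subspace[OF insert.hyps(1)], of 0]
      subspace_0[OF triangular_subspace[OF insert.hyps(1)]] by auto
  obtain q where q: "q \<in> W" "represents q w" using insert.IH s(1) by blast
  have "q + c *\<^sub>R (l *\<^sub>R f + r) \<in> span (insert f W)"
    using q(1) insert.hyps(2) by (intro span_add span_scale span_base) auto
  then show ?case
    using represents_add[OF q(2) represents_scaleR[OF insert.hyps(4)]] s(2) by blast
qed

lemma triangular_projection:
  assumes "triangular W" "k \<in> F"
  shows "\<exists>p\<in>W. \<forall>s\<in>W. C (k - p) s = 0"
  using assms
proof (induction arbitrary: k rule: triangular.induct)
  case zero
  then show ?case by (simp add: zero_right)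
next
  case (insert W r l f)
  note W_subspace = triangular_subspace[OF insert.hyps(1)]
  note W_F = triangular_subset[OF insert.hyps(1), THEN subsetD]
  have f: "f \<in> F" using insert.hyps(4) by (rule representsD)
  obtain p where p: "p \<in> W" "\<And>s. s \<in> W \<Longrightarrow> C (f - p) s = 0" using insert.IH[OF f] by blast
  obtain q where q: "q \<in> W" "\<And>s. s \<in> W \<Longrightarrow> C (k - q) s = 0" using insert.IH[OF insert.prems] by blast
  define h where "h = f - p"
  define c where "c = C k h / C h h"
  have h: "h \<in> F" using f p(1) W_F by (auto simp: h_def carrier_closed)
  have h_orth: "C h s = 0" "C s h = 0" if "s \<in> W" for s
    using p(2)[OF that] commute[OF h W_F[OF that]] by (simp_all add: h_def)
  have c: "C k h = c * C h h"
    using form_null[OF insert.prems h] by (cases "C h h = 0") (auto simp: c_def)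
  have "C (k - (q + c *\<^sub>R h)) w = 0" if w: "w \<in> span (insert f W)" for w
  proof -
    obtain s t where w: "s \<in> W" "w = s + t *\<^sub>R h"
      using span_insert_residualE[OF w W_subspace p(1)] by (auto simp: h_def)
    have "C (k - (q + c *\<^sub>R h)) s = C (k - q) s"
      using q(1) w(1) h insert.prems W_F by (simp add: bilinear carrier_closed h_orth)
    moreover have "C (k - (q + c *\<^sub>R h)) h = 0"
      using q(1) h insert.prems W_F by (simp add: bilinear carrier_closed h_orth c)
    ultimately show ?thesis
      using q w h insert.prems W_F by (simp add: add_right scaleR_right carrier_closed)
  qed
  moreover have "q + c *\<^sub>R h \<in> span (insert f W)"
    unfolding h_def using q(1) p(1) by (intro span_add span_scale span_diff span_base) auto
  ultimately show ?case by blast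
qed

lemma triangular_residualE:
  assumes W: "triangular W" and r: "r \<in> W" and f: "represents (l *\<^sub>R f + r) f"
  obtains p where "p \<in> W" "\<And>s. s \<in> W \<Longrightarrow> C (f - p) s = 0" "\<And>s. s \<in> W \<Longrightarrow> B (f - p) s = 0"
    "B (f - p) (f - p) = l * C (f - p) (f - p)"
proof -
  note W_F = triangular_subset[OF W, THEN subsetD]
  obtain p where p: "p \<in> W" "\<And>s. s \<in> W \<Longrightarrow> C (f - p) s = 0"
    using triangular_projection[OF W representsD(1)[OF f]] by blast
  obtain q where q: "q \<in> W" "represents q p" using triangular_represents[OF W p(1)] by blast
  define h where "h = f - p"
  have h: "h \<in> F" using representsD(1)[OF f] p(1) W_F by (auto simp: h_def carrier_closed)
  have C_orth: "C s h = 0" if "s \<in> W" for s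
    using p(2)[OF that] commute[OF h W_F[OF that]] by (simp add: h_def)
  have B_orth: "B h s = 0" if s: "s \<in> W" for s
  proof -
    obtain r' where "r' \<in> W" "represents r' s" using triangular_represents[OF W s] by blast
    then have "B s h = 0" using C_orth representsD(3) h by simp
    then show ?thesis using B.commute[OF h W_F[OF s]] by simp
  qed
  have "represents (l *\<^sub>R f + r - q) h"
    unfolding h_def by (rule represents_diff[OF f q(2)])
  moreover have "l *\<^sub>R f + r - q = l *\<^sub>R h + (l *\<^sub>R p + r - q)"
    by (simp add: h_def algebra_simps)
  moreover have "l *\<^sub>R p + r - q \<in> W"
    using p(1) q(1) r triangular_subspace[OF W] by (intro subspace_diff subspace_add subspace_scale)
  ultimately have "B h h = l * C h h"
    using representsD(3)[of "l *\<^sub>R h + (l *\<^sub>R p + r - q)" h h] h W_F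
    by (simp add: add_left scaleR_left carrier_closed C_orth)
  then show thesis using that[of p] p B_orth by (simp add: h_def)
qed

lemma triangular_bound:
  assumes "triangular W" "w \<in> W"
  shows "\<bar>B w w\<bar> \<le> \<kappa> * C w w"
  using assms
proof (induction arbitrary: w rule: triangular.induct)
  case zero
  then show ?case by (simp add: zero_left B.zero_left carrier_closed)
next
  case (insert W r l f)
  obtain p where p: "p \<in> W" "\<And>s. s \<in> W \<Longrightarrow> C (f - p) s = 0" "\<And>s. s \<in> W \<Longrightarrow> B (f - p) s = 0"
      "B (f - p) (f - p) = l * C (f - p) (f - p)"
    using insert.hyps(1,2,4) by (rule triangular_residualE) blast
  define h where "h = f - p"
  obtain s t where w: "s \<in> W" "w = s + t *\<^sub>R h"
    using span_insert_residualE[OF insert.prems triangular_subspace[OF insert.hyps(1)] p(1)]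
    by (auto simp: h_def)
  have F: "s \<in> F" "h \<in> F"
    using triangular_subset[OF insert.hyps(1)] w(1) p(1) representsD(1)[OF insert.hyps(4)]
    by (auto simp: h_def carrier_closed)
  have C_orth: "C h s = 0" "C s h = 0" and B_orth: "B h s = 0" "B s h = 0"
    using p(2,3)[OF w(1)] commute[OF F] B.commute[OF F] by (simp_all add: h_def)
  have "\<bar>B w w\<bar> = \<bar>B s s + t\<^sup>2 * (l * C h h)\<bar>"
    using F p(4) by (simp add: w(2) B.bilinear carrier_closed B_orth h_def[symmetric] power2_eq_square)
  also have "\<dots> \<le> \<bar>B s s\<bar> + t\<^sup>2 * (\<bar>l\<bar> * C h h)"
    using abs_triangle_ineq[of "B s s" "t\<^sup>2 * (l * C h h)"] nonneg[OF F(2)] by (simp add: abs_mult)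
  also have "\<dots> \<le> \<kappa> * C s s + t\<^sup>2 * (\<kappa> * C h h)"
    using insert.IH[OF w(1)] insert.hyps(3) nonneg[OF F(2)]
    by (intro add_mono mult_left_mono mult_right_mono) auto
  also have "\<dots> = \<kappa> * C w w"
    using F by (simp add: w(2) bilinear carrier_closed C_orth power2_eq_square algebra_simps)
  finally show ?case .
qed

end

section \<open>Square-integrable functions\<close>

instantiation "fun" :: (type, real_vector) real_vector
begin

definition scaleR_fun_def: "c *\<^sub>R f = (\<lambda>x. c *\<^sub>R f x)"

instance
  by standard (simp_all add: scaleR_fun_def fun_eq_iff scaleR_add_right scaleR_add_left)

end

lemma scaleR_fun_apply [simp]: "(c *\<^sub>R f) x = c *\<^sub>R f x"
  by (simp add: scaleR_fun_def)

lemma sum_fun_apply [simp]: "(\<Sum>i\<in>I. f i) x = (\<Sum>i\<in>I. f i x)"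
  by (induction I rule: infinite_finite_induct) simp_all

lemma L2_realD [measurable_dest]:
  assumes "f \<in> L2_real M"
  shows "f \<in> borel_measurable M" "integrable M (\<lambda>x. (f x)\<^sup>2)"
  using assms by (auto simp: L2_real_def)

lemma L2_real_mult_integrable:
  assumes "f \<in> L2_real M" "g \<in> L2_real M"
  shows "integrable M (\<lambda>x. f x * g x)"
proof (rule Bochner_Integration.integrable_bound)
  show "integrable M (\<lambda>x. (f x)\<^sup>2 + (g x)\<^sup>2)"
    using assms by (auto dest: L2_realD)
  show "(\<lambda>x. f x * g x) \<in> borel_measurable M"
    using assms[THEN L2_realD(1)] by auto
  have "\<bar>a * b\<bar> \<le> a\<^sup>2 + b\<^sup>2" for a b :: real
    using sum_squares_bound[of "\<bar>a\<bar>" "\<bar>b\<bar>"] mult_nonneg_nonneg[of "\<bar>a\<bar>" "\<bar>b\<bar>"]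
    unfolding abs_mult power2_abs by linarith
  then show "AE x in M. norm (f x * g x) \<le> norm ((f x)\<^sup>2 + (g x)\<^sup>2)" by simp
qed

lemma subspace_L2_real: "subspace (L2_real M)"
proof (rule subspaceI)
  show "f + g \<in> L2_real M" if "f \<in> L2_real M" "g \<in> L2_real M" for f g
    using that L2_real_mult_integrable[OF that]
    by (auto simp: L2_real_def plus_fun_def power2_sum mult.assoc)
qed (auto simp: L2_real_def zero_fun_def scaleR_fun_def power_mult_distrib)

lemma (in finite_measure) L2_real_const: "(\<lambda>_. c) \<in> L2_real M"
  by (simp add: L2_real_def)

lemma (in finite_measure) L2_real_integrable: "f \<in> L2_real M \<Longrightarrow> integrable M f"
  using L2_real_mult_integrable[OF _ L2_real_const[of 1]] by simp

lemma L2_real_abs: "f \<in> L2_real M \<Longrightarrow> (\<lambda>x. \<bar>f x\<bar>) \<in> L2_real M"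
  by (auto simp: L2_real_def)

lemma L2_real_bounded_by:
  assumes "f \<in> borel_measurable M" "g \<in> L2_real M" "\<And>x. x \<in> space M \<Longrightarrow> \<bar>f x\<bar> \<le> g x"
  shows "f \<in> L2_real M"
  unfolding L2_real_def
proof safe
  show "integrable M (\<lambda>x. (f x)\<^sup>2)"
  proof (rule Bochner_Integration.integrable_bound)
    show "integrable M (\<lambda>x. (g x)\<^sup>2)" using assms(2) by (rule L2_realD)
    show "AE x in M. norm ((f x)\<^sup>2) \<le> norm ((g x)\<^sup>2)"
      using power_mono[OF assms(3), of _ 2] by (intro AE_I2) auto
  qed (use assms in auto)
qed (rule assms)

definition L2_inner :: "'a measure \<Rightarrow> ('a \<Rightarrow> real) \<Rightarrow> ('a \<Rightarrow> real) \<Rightarrow> real" where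
  "L2_inner M f g = (LINT x|M. f x * g x)"

global_interpretation L2: semidefinite_form "L2_real M" "L2_inner M" for M
  defines L2_norm = L2.seminorm and L2_closure = L2.form_closure
proof
  show "subspace (L2_real M)" by (rule subspace_L2_real)
  fix f g h assume f: "f \<in> L2_real M" and g: "g \<in> L2_real M" and h: "h \<in> L2_real M"
  show "L2_inner M (f + g) h = L2_inner M f h + L2_inner M g h"
    using L2_real_mult_integrable[OF f h] L2_real_mult_integrable[OF g h]
    by (simp add: L2_inner_def distrib_right)
  show "L2_inner M (c *\<^sub>R f) h = c * L2_inner M f h" for c
    by (simp add: L2_inner_def mult.assoc)
  show "L2_inner M f g = L2_inner M g f"
    by (simp add: L2_inner_def mult.commute)
qed (simp add: L2_inner_def)

lemma L2_norm_eq: "L2_norm M f = sqrt (LINT x|M. (f x)\<^sup>2)"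
  by (simp add: L2.seminorm_def L2_inner_def power2_eq_square)

lemma L2_closure_dominated:
  assumes P: "P \<subseteq> L2_real M" and s: "\<And>n. s n \<in> L2_closure M P"
    and f: "f \<in> borel_measurable M" and lim: "\<And>x. x \<in> space M \<Longrightarrow> (\<lambda>n. s n x) \<longlonglongrightarrow> f x"
    and w: "w \<in> L2_real M" and dom: "\<And>n x. x \<in> space M \<Longrightarrow> \<bar>s n x\<bar> \<le> w x"
  shows "f \<in> L2_closure M P"
proof (rule L2.form_closure_idem[OF P])
  note sL2 = subsetD[OF L2.form_closure_subset s]
  have fw: "\<bar>f x\<bar> \<le> w x" if "x \<in> space M" for x
    using tendsto_rabs[OF lim[OF that]] by (rule Lim_bounded) (use dom that in auto)
  have "f \<in> L2_real M" using f w fw by (rule L2_real_bounded_by)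
  moreover have "(\<lambda>n. LINT x|M. (f x - s n x)\<^sup>2) \<longlonglongrightarrow> (LINT x|M. 0)"
  proof (rule integral_dominated_convergence)
    show "integrable M (\<lambda>x. 4 * (w x)\<^sup>2)" using w by (auto dest: L2_realD)
    show "AE x in M. (\<lambda>n. (f x - s n x)\<^sup>2) \<longlonglongrightarrow> 0"
      by (intro AE_I2) (rule tendsto_eq_intros lim refl | assumption | simp)+
    show "AE x in M. norm ((f x - s n x)\<^sup>2) \<le> 4 * (w x)\<^sup>2" for n
    proof (rule AE_I2)
      fix x assume "x \<in> space M"
      then have "\<bar>f x - s n x\<bar> \<le> 2 * w x" using fw[of x] dom[of x n] by linarith
      then have "\<bar>f x - s n x\<bar>\<^sup>2 \<le> (2 * w x)\<^sup>2" by (rule power_mono) simp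
      then show "norm ((f x - s n x)\<^sup>2) \<le> 4 * (w x)\<^sup>2" by (simp add: power_mult_distrib)
    qed
    show "(\<lambda>x. (f x - s n x)\<^sup>2) \<in> borel_measurable M" for n
      using f L2_realD(1)[OF sL2] by measurable
  qed auto
  from tendsto_real_sqrt[OF this] have "(\<lambda>n. L2_norm M (f - s n)) \<longlonglongrightarrow> 0"
    by (simp add: L2_norm_eq)
  then have "\<exists>n. L2_norm M (f - s n) < e" if "e > 0" for e
    using order_tendstoD(2)[OF _ that] eventually_happens'[OF sequentially_bot] by fast
  ultimately show "f \<in> L2_closure M (L2_closure M P)"
    using s unfolding L2.form_closure_def by blast
qed

lemma L2_closure_cong:
  assumes P: "P \<subseteq> L2_real M" and f: "f \<in> L2_closure M P" and eq: "\<And>x. x \<in> space M \<Longrightarrow> f x = g x"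
  shows "g \<in> L2_closure M P"
proof (rule L2_closure_dominated[OF P, of "\<lambda>_. f"])
  have "f \<in> L2_real M" using f L2.form_closure_subset by blast
  then show "g \<in> borel_measurable M" "(\<lambda>x. \<bar>f x\<bar>) \<in> L2_real M"
    using measurable_cong[of M f g] eq by (auto intro: L2_real_abs dest: L2_realD)
qed (use f eq in auto)

lemma L2_closure_eqI_indicator:
  assumes P: "subspace P" "P \<subseteq> L2_real M"
    and indicator: "\<And>A. A \<in> sets M \<Longrightarrow> indicator A \<in> L2_closure M P"
  shows "L2_closure M P = L2_real M"
proof (intro equalityI subsetI)
  fix f assume f: "f \<in> L2_real M"
  obtain s where s: "\<And>i. simple_function M (s i)" "\<And>x. x \<in> space M \<Longrightarrow> (\<lambda>i. s i x) \<longlonglongrightarrow> f x"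
    "\<And>i x. x \<in> space M \<Longrightarrow> \<bar>s i x\<bar> \<le> 2 * \<bar>f x\<bar>"
    using borel_measurable_implies_sequence_metric[OF L2_realD(1)[OF f], of 0]
    by (simp add: dist_real_def) metis
  show "f \<in> L2_closure M P"
  proof (rule L2_closure_dominated[OF P(2), where s = s and w = "2 *\<^sub>R (\<lambda>x. \<bar>f x\<bar>)"])
    show "s i \<in> L2_closure M P" for i
    proof (rule L2_closure_cong[OF P(2)])
      show "(\<Sum>y\<in>s i ` space M. y *\<^sub>R indicator (s i -` {y} \<inter> space M)) \<in> L2_closure M P"
        using L2.subspace_form_closure[OF P] simple_functionD(2)[OF s(1)]
        by (intro subspace_sum subspace_scale indicator)
      show "(\<Sum>y\<in>s i ` space M. y *\<^sub>R indicator (s i -` {y} \<inter> space M)) x = s i x"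
        if "x \<in> space M" for x
        using that simple_functionD(1)[OF s(1), of i]
        by (simp add: indicator_def if_distrib[where f = "\<lambda>c. _ * c"] cong: if_cong)
    qed
    show "2 *\<^sub>R (\<lambda>x. \<bar>f x\<bar>) \<in> L2_real M"
      using f by (intro L2.carrier_closed L2_real_abs)
  qed (use s L2_realD(1)[OF f] in auto)
qed (use L2.form_closure_subset in auto)

section \<open>Density of the powers of linear functionals\<close>

locale compact_measure = finite_measure M for M :: "'a::euclidean_space measure" +
  fixes S :: "'a set"
  assumes compact: "compact S" and sets_eq_restrict: "sets M = sets (restrict_space borel S)"
begin

lemma space_eq: "space M = S"
  using sets_eq_imp_space_eq[OF sets_eq_restrict] by (simp add: space_restrict_space)

lemma borel_measurable_restrict:
  fixes f :: "'a \<Rightarrow> real"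
  shows "f \<in> borel_measurable borel \<Longrightarrow> f \<in> borel_measurable M"
  unfolding measurable_cong_sets[OF sets_eq_restrict refl] by (rule measurable_restrict_space1)

lemma continuous_on_L2_real:
  fixes f :: "'a \<Rightarrow> real"
  assumes f: "continuous_on S f"
  shows "f \<in> L2_real M"
proof -
  have "f \<in> borel_measurable M"
    unfolding measurable_cong_sets[OF sets_eq_restrict refl]
    by (rule borel_measurable_continuous_on_restrict[OF f])
  moreover obtain K where "\<And>x. x \<in> S \<Longrightarrow> \<bar>f x\<bar> \<le> K"
    using compact_imp_bounded[OF compact_continuous_image[OF f compact]] by (auto simp: bounded_iff)
  ultimately show ?thesis
    by (intro L2_real_bounded_by[OF _ L2_real_const[of K]]) (auto simp: space_eq)
qed

lemma L2_norm_le_uniform: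
  assumes "f \<in> L2_real M" "\<And>x. x \<in> S \<Longrightarrow> \<bar>f x\<bar> \<le> c" "c \<ge> 0"
  shows "L2_norm M f \<le> c * sqrt (measure M S)"
proof -
  have "(LINT x|M. (f x)\<^sup>2) \<le> (LINT x|M. c\<^sup>2)"
    using assms power_mono[OF assms(2), of _ 2] by (intro integral_mono) (auto simp: space_eq dest: L2_realD)
  then have "L2_norm M f \<le> sqrt (c\<^sup>2 * measure M S)"
    by (simp add: L2_norm_eq space_eq mult.commute)
  then show ?thesis using assms(3) by (simp add: real_sqrt_mult)
qed

lemma L2_closure_uniform_limit:
  assumes P: "P \<subseteq> L2_real M" and f: "f \<in> L2_real M"
    and approx: "\<And>\<delta>. \<delta> > 0 \<Longrightarrow> \<exists>g\<in>L2_closure M P. \<forall>x\<in>S. \<bar>f x - g x\<bar> < \<delta>"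
  shows "f \<in> L2_closure M P"
proof (rule L2.form_closure_idem[OF P])
  have "\<exists>g\<in>L2_closure M P. L2_norm M (f - g) < e" if "e > 0" for e
  proof -
    have m: "sqrt (measure M S) + 1 > 0" by (simp add: add_nonneg_pos)
    then obtain g where g: "g \<in> L2_closure M P" "\<And>x. x \<in> S \<Longrightarrow> \<bar>f x - g x\<bar> < e / (sqrt (measure M S) + 1)"
      using approx[of "e / (sqrt (measure M S) + 1)"] \<open>e > 0\<close> by auto
    have "f - g \<in> L2_real M"
      using f g(1) L2.form_closure_subset by (intro L2.carrier_closed) auto
    then have "L2_norm M (f - g) \<le> e / (sqrt (measure M S) + 1) * sqrt (measure M S)"
      using g(2) \<open>e > 0\<close> m by (intro L2_norm_le_uniform) (auto intro: less_imp_le)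
    also have "\<dots> < e" using \<open>e > 0\<close> m by (simp add: field_simps)
    finally show ?thesis using g(1) by blast
  qed
  then show "f \<in> L2_closure M (L2_closure M P)"
    using f by (auto simp: L2.form_closure_def)
qed

lemma indicator_closed_L2_closure:
  assumes P: "P \<subseteq> L2_real M"
    and cont: "\<And>f. continuous_on S f \<Longrightarrow> f \<in> L2_closure M P"
    and A: "closed A"
  shows "indicator A \<in> L2_closure M P"
proof (cases "A = {}")
  case True
  have "(\<lambda>_. 0) \<in> L2_closure M P" by (intro cont continuous_on_const)
  then show ?thesis using True by (simp add: indicator_def[abs_def])
next
  case nonempty: False
  show ?thesis
  proof (rule L2_closure_dominated[OF P])
    let ?s = "\<lambda>n x. max 0 (1 - real n * infdist x A)"
    show "?s n \<in> L2_closure M P" for n by (intro cont continuous_intros)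
    show "(\<lambda>n. ?s n x) \<longlonglongrightarrow> indicator A x" for x
    proof (cases "x \<in> A")
      case False
      then have "infdist x A > 0"
        using A nonempty in_closed_iff_infdist_zero[of A x] infdist_nonneg[of x A] by force
      then have "\<forall>\<^sub>F n in sequentially. 1 / infdist x A \<le> real n"
        using filterlim_real_sequentially by (simp add: filterlim_at_top)
      then have "\<forall>\<^sub>F n in sequentially. ?s n x = 0"
        by (rule eventually_mono) (use \<open>infdist x A > 0\<close> in \<open>simp add: divide_le_eq\<close>)
      then show ?thesis using False by (simp add: tendsto_eventually)
    qed simp
    show "(\<lambda>_. 1) \<in> L2_real M" by (rule L2_real_const)
    show "\<bar>?s n x\<bar> \<le> 1" for n x by (simp add: infdist_nonneg)
    show "(indicator A :: 'a \<Rightarrow> real) \<in> borel_measurable M"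
      using A by (intro borel_measurable_restrict) simp
  qed
qed

lemma indicator_UN_L2_closure:
  fixes A :: "nat \<Rightarrow> 'a set"
  assumes P: "subspace P" "P \<subseteq> L2_real M"
    and A: "disjoint_family A" "\<And>n. A n \<in> sets borel" "\<And>n. indicator (A n) \<in> L2_closure M P"
  shows "indicator (\<Union> (range A)) \<in> L2_closure M P"
proof (rule L2_closure_dominated[OF P(2)])
  have partial: "(\<Sum>i<n. indicator (A i)) x = (indicator (\<Union>i<n. A i) x :: real)" for n x
    using A(1) by (simp add: indicator_UN_disjoint disjoint_family_on_def)
  show "(\<Sum>i<n. indicator (A i)) \<in> L2_closure M P" for n
    by (intro subspace_sum[OF L2.subspace_form_closure[OF P]] A(3))
  show "(\<lambda>n. (\<Sum>i<n. indicator (A i)) x) \<longlonglongrightarrow> (indicator (\<Union> (range A)) x :: real)" for x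
    unfolding partial using LIMSEQ_indicator_UN[of A x] by simp
  show "\<bar>(\<Sum>i<n. indicator (A i)) x\<bar> \<le> (1::real)" for n x
    unfolding partial by (simp add: indicator_def)
  show "(\<lambda>_. 1) \<in> L2_real M" by (rule L2_real_const)
  show "(indicator (\<Union> (range A)) :: 'a \<Rightarrow> real) \<in> borel_measurable M"
    using A(2) by (intro borel_measurable_restrict borel_measurable_indicator sets.countable_UN) auto
qed

lemma indicator_L2_closure:
  assumes P: "subspace P" "P \<subseteq> L2_real M"
    and cont: "\<And>f. continuous_on S f \<Longrightarrow> f \<in> L2_closure M P"
    and A: "A \<in> sets borel"
  shows "indicator A \<in> L2_closure M P"
proof -
  note closure = L2.subspace_form_closure[OF P]
  have "A \<in> sigma_sets UNIV (Collect closed)" using A by (simp add: borel_eq_closed)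
  then show ?thesis
  proof (rule sigma_sets_induct_disjoint[rotated 2, where P = "\<lambda>A. indicator A \<in> L2_closure M P"])
    show "Int_stable (Collect (closed :: 'a set \<Rightarrow> bool))" by (auto simp: Int_stable_def)
    show "indicator ({} :: 'a set) \<in> L2_closure M P"
      by (rule indicator_closed_L2_closure[OF P(2) cont]) simp_all
    show "indicator A \<in> L2_closure M P" if "A \<in> Collect closed" for A :: "'a set"
      using that by (intro indicator_closed_L2_closure[OF P(2) cont]) simp_all
    show "indicator (UNIV - A) \<in> L2_closure M P" if "indicator A \<in> L2_closure M P" for A :: "'a set"
    proof -
      have "(\<lambda>_. 1) - indicator A \<in> L2_closure M P"
        by (rule subspace_diff[OF closure cont[OF continuous_on_const] that])
      moreover have "(\<lambda>_. 1) - indicator A = (indicator (UNIV - A) :: 'a \<Rightarrow> real)"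
        by (auto simp: fun_eq_iff indicator_def)
      ultimately show ?thesis by simp
    qed
    show "indicator (\<Union> (range A)) \<in> L2_closure M P"
      if "disjoint_family A" "range A \<subseteq> sigma_sets UNIV (Collect closed)"
        "\<And>i. indicator (A i) \<in> L2_closure M P" for A :: "nat \<Rightarrow> 'a set"
      using that by (intro indicator_UN_L2_closure[OF P]) (auto simp: borel_eq_closed)
  qed auto
qed

lemma L2_closure_eqI_continuous:
  assumes "subspace P" "P \<subseteq> L2_real M" "\<And>f. continuous_on S f \<Longrightarrow> f \<in> L2_closure M P"
  shows "L2_closure M P = L2_real M"
proof (rule L2_closure_eqI_indicator[OF assms(1,2)])
  fix A assume "A \<in> sets M"
  then have "A \<in> sets borel"
    using compact_imp_closed[OF compact] by (simp add: sets_eq_restrict sets_restrict_space_iff)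
  with assms show "indicator A \<in> L2_closure M P" by (rule indicator_L2_closure)
qed

end

definition linear_powers :: "('a::euclidean_space \<Rightarrow> real) set" where
  "linear_powers = span (range (\<lambda>(a, n) x. (a \<bullet> x) ^ n))"

text \<open>
  That \<open>linear_powers\<close> is closed under products would need polarization. For exponentials this is
  evident, and their power series lead back to \<open>linear_powers\<close>.
\<close>

definition linear_exponentials :: "('a::euclidean_space \<Rightarrow> real) set" where
  "linear_exponentials = span (range (\<lambda>a x. exp (a \<bullet> x)))"

lemma subspace_continuous_on: "subspace {f :: 'a::topological_space \<Rightarrow> real. continuous_on S f}"
  by (rule subspaceI) (auto simp: plus_fun_def zero_fun_def scaleR_fun_def intro!: continuous_intros)

lemma linear_powers_continuous: "p \<in> linear_powers \<Longrightarrow> continuous_on S p"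
  unfolding linear_powers_def
  by (drule subsetD[OF span_minimal[OF _ subspace_continuous_on[of S]], rotated])
    (auto intro!: continuous_intros)

lemma linear_exponentials_continuous: "p \<in> linear_exponentials \<Longrightarrow> continuous_on S p"
  unfolding linear_exponentials_def
  by (drule subsetD[OF span_minimal[OF _ subspace_continuous_on[of S]], rotated])
    (auto intro!: continuous_intros)

lemma linear_exponentials_mult:
  assumes "p \<in> linear_exponentials" "q \<in> linear_exponentials"
  shows "(\<lambda>x. p x * q x) \<in> linear_exponentials"
  using assms(1) unfolding linear_exponentials_def
proof (induction rule: span_induct_alt)
  case base
  then show ?case by (simp add: span_zero flip: zero_fun_def)
next
  case (step c e p)
  then obtain a where e: "e = (\<lambda>x. exp (a \<bullet> x))" by auto
  have "(\<lambda>x. exp (a \<bullet> x) * q x) \<in> span (range (\<lambda>a x. exp (a \<bullet> x)))"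
    using assms(2) unfolding linear_exponentials_def
  proof (induction rule: span_induct_alt)
    case base
    then show ?case by (simp add: span_zero flip: zero_fun_def)
  next
    case (step c e q)
    then obtain b where "e = (\<lambda>x. exp (b \<bullet> x))" by auto
    then have "(\<lambda>x. exp (a \<bullet> x) * (c *\<^sub>R e + q) x) =
        c *\<^sub>R (\<lambda>x. exp ((a + b) \<bullet> x)) + (\<lambda>x. exp (a \<bullet> x) * q x)"
      by (simp add: fun_eq_iff inner_add_left exp_add algebra_simps)
    then show ?case using step.IH by (simp add: span_add span_scale span_base)
  qed
  then have "c *\<^sub>R (\<lambda>x. exp (a \<bullet> x) * q x) + (\<lambda>x. p x * q x) \<in> span (range (\<lambda>a x. exp (a \<bullet> x)))"
    using step.IH by (intro span_add span_scale)
  moreover have "c *\<^sub>R (\<lambda>x. exp (a \<bullet> x) * q x) + (\<lambda>x. p x * q x) = (\<lambda>x. (c *\<^sub>R e + p) x * q x)"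
    by (simp add: fun_eq_iff e algebra_simps)
  ultimately show ?case by simp
qed

lemma function_ring_on_linear_exponentials:
  assumes "compact S"
  shows "function_ring_on linear_exponentials (S :: 'a::euclidean_space set)"
proof
  show "compact S" by fact
  show "continuous_on S p" if "p \<in> linear_exponentials" for p :: "'a \<Rightarrow> real"
    using that by (rule linear_exponentials_continuous)
  show "(\<lambda>x. p x + q x) \<in> linear_exponentials"
    if "p \<in> linear_exponentials" "q \<in> linear_exponentials" for p q :: "'a \<Rightarrow> real"
    using span_add[OF that[unfolded linear_exponentials_def]]
    by (simp add: linear_exponentials_def plus_fun_def)
  show "(\<lambda>x. p x * q x) \<in> linear_exponentials"
    if "p \<in> linear_exponentials" "q \<in> linear_exponentials" for p q :: "'a \<Rightarrow> real"
    using that by (rule linear_exponentials_mult)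
  have base: "(\<lambda>x. exp (a \<bullet> x)) \<in> linear_exponentials" for a :: 'a
    unfolding linear_exponentials_def by (intro span_base) auto
  show "(\<lambda>_. c) \<in> (linear_exponentials :: ('a \<Rightarrow> real) set)" for c
    using span_scale[of "\<lambda>x :: 'a. exp (0 \<bullet> x)" _ c] base[of 0]
    by (simp add: linear_exponentials_def scaleR_fun_def)
  show "\<exists>p\<in>linear_exponentials. p x \<noteq> p y" if "x \<noteq> y" for x y :: 'a
  proof (intro bexI[OF _ base[of "x - y"]])
    have "(x - y) \<bullet> (x - y) \<noteq> 0" using that by simp
    then show "exp ((x - y) \<bullet> x) \<noteq> exp ((x - y) \<bullet> y)" by (simp add: inner_diff_right)
  qed
qed

context compact_measure
begin

lemma linear_powers_L2: "linear_powers \<subseteq> L2_real M"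
  using linear_powers_continuous continuous_on_L2_real by blast

lemma exp_linear_L2_closure: "(\<lambda>x. exp (a \<bullet> x)) \<in> L2_closure M linear_powers"
proof (rule L2_closure_dominated[OF linear_powers_L2])
  let ?s = "\<lambda>N. \<Sum>n<N. inverse (fact n) *\<^sub>R (\<lambda>x. (a \<bullet> x) ^ n)"
  show "?s N \<in> L2_closure M linear_powers" for N
    unfolding linear_powers_def
    by (intro subsetD[OF L2.form_closure_superset] linear_powers_L2[unfolded linear_powers_def]
        span_sum span_scale span_base) auto
  show "(\<lambda>N. ?s N x) \<longlonglongrightarrow> exp (a \<bullet> x)" for x
    using exp_converges[of "a \<bullet> x"] by (simp add: sums_def)
  show "(\<lambda>x. exp \<bar>a \<bullet> x\<bar>) \<in> L2_real M" by (intro continuous_on_L2_real continuous_intros)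
  show "\<bar>?s N x\<bar> \<le> exp \<bar>a \<bullet> x\<bar>" for N x
  proof -
    have "\<bar>?s N x\<bar> \<le> (\<Sum>n<N. inverse (fact n) * \<bar>a \<bullet> x\<bar> ^ n)"
      using sum_abs[of "\<lambda>n. inverse (fact n) * (a \<bullet> x) ^ n" "{..<N}"] by (simp add: abs_mult power_abs)
    also have "\<dots> \<le> exp \<bar>a \<bullet> x\<bar>"
      using exp_converges[of "\<bar>a \<bullet> x\<bar>"]
        sum_le_suminf[of "\<lambda>n. inverse (fact n) * \<bar>a \<bullet> x\<bar> ^ n" "{..<N}"] by (simp add: sums_iff)
    finally show ?thesis .
  qed
  show "(\<lambda>x. exp (a \<bullet> x)) \<in> borel_measurable M"
    by (intro L2_realD(1) continuous_on_L2_real continuous_intros)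
qed

theorem linear_powers_dense_L2: "L2_closure M linear_powers = L2_real M"
proof (rule L2_closure_eqI_continuous)
  show P: "subspace (linear_powers :: ('a \<Rightarrow> real) set)" by (simp add: linear_powers_def)
  show "linear_powers \<subseteq> L2_real M" by (rule linear_powers_L2)
  have exponentials: "linear_exponentials \<subseteq> L2_closure M linear_powers"
    unfolding linear_exponentials_def
    by (intro span_minimal L2.subspace_form_closure P linear_powers_L2) (auto intro: exp_linear_L2_closure)
  fix f :: "'a \<Rightarrow> real" assume f: "continuous_on S f"
  interpret function_ring_on linear_exponentials S
    by (rule function_ring_on_linear_exponentials[OF compact])
  show "f \<in> L2_closure M linear_powers"
    using Stone_Weierstrass_basic[OF f] exponentials
    by (intro L2_closure_uniform_limit linear_powers_L2 continuous_on_L2_real f) blast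
qed

end

section \<open>The uniform measure on the sphere\<close>

lemma nn_integral_lborel_translate:
  fixes c :: "'a::euclidean_space"
  assumes [measurable]: "f \<in> borel_measurable borel"
  shows "(\<integral>\<^sup>+x. f (x + c) \<partial>lborel) = (\<integral>\<^sup>+x. f x \<partial>lborel)"
proof -
  have "(\<integral>\<^sup>+x. f x \<partial>lborel) = (\<integral>\<^sup>+x. f x \<partial>distr lborel borel ((+) c))"
    by (simp add: lborel_distr_plus)
  also have "\<dots> = (\<integral>\<^sup>+x. f (x + c) \<partial>lborel)"
    by (subst nn_integral_distr) (auto simp: add.commute)
  finally show ?thesis ..
qed

lemma emeasure_lborel_open_neq_0:
  fixes U :: "'a::euclidean_space set"
  assumes "open U" "U \<noteq> {}"
  shows "emeasure lborel U \<noteq> 0"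
  using open_not_negligible[OF assms] null_sets_completionI[of U lborel] assms(1)
  by (auto simp: negligible_iff_null_sets null_sets_def)

lemma linear_borel_measurable:
  fixes f :: "'a::euclidean_space \<Rightarrow> 'b::euclidean_space"
  assumes "linear f"
  shows "f \<in> borel_measurable borel"
  using linear_continuous_on[OF linear_conv_bounded_linear[THEN iffD1, OF assms]]
  by (rule borel_measurable_continuous_onI)

lemma nn_integral_linear_image_translate:
  fixes f :: "'a::euclidean_space \<Rightarrow> 'b::euclidean_space"
  assumes f: "linear f" "surj f" and [measurable]: "g \<in> borel_measurable borel"
  shows "(\<integral>\<^sup>+x. g (f x + c) \<partial>lborel) = (\<integral>\<^sup>+x. g (f x) \<partial>lborel)"
proof -
  note [measurable] = linear_borel_measurable[OF f(1)]
  obtain c' where "c = f c'" using f(2) by auto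
  then show ?thesis
    using nn_integral_lborel_translate[of "\<lambda>x. g (f x)" c'] by (simp add: linear_add[OF f(1)])
qed

text \<open>
  The image of \<open>lborel\<close> is translation invariant. Integrating \<open>indicator A (f x + y) * indicator B y\<close>
  over \<open>x\<close> and \<open>y\<close> in both orders shows that it is proportional to \<open>lborel\<close>.
\<close>

lemma emeasure_distr_lborel_linear:
  fixes f :: "'a::euclidean_space \<Rightarrow> 'b::euclidean_space"
  assumes f: "linear f" "surj f" and [measurable]: "A \<in> sets borel" "B \<in> sets borel"
  shows "emeasure (distr lborel borel f) A * emeasure lborel B =
    emeasure lborel A * (\<integral>\<^sup>+x. indicator B (- f x) \<partial>lborel)"
proof -
  note [measurable] = linear_borel_measurable[OF f(1)]
  have image_A: "(\<integral>\<^sup>+x. indicator A (f x + y) \<partial>lborel) = emeasure (distr lborel borel f) A" for y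
  proof -
    have "(\<integral>\<^sup>+x. indicator A (f x + y) \<partial>lborel) = (\<integral>\<^sup>+x. indicator A (f x) \<partial>lborel)"
      by (rule nn_integral_linear_image_translate[OF f]) simp
    also have "\<dots> = (\<integral>\<^sup>+x. indicator A x \<partial>distr lborel borel f)"
      by (rule nn_integral_distr[symmetric]) simp_all
    finally show ?thesis by simp
  qed
  have image_B: "(\<integral>\<^sup>+x. indicator B (y - f x) \<partial>lborel) = (\<integral>\<^sup>+x. indicator B (- f x) \<partial>lborel)" for y
    using nn_integral_linear_image_translate[OF f, of "\<lambda>z. indicator B (- z)" "- y"] by simp
  have "emeasure (distr lborel borel f) A * emeasure lborel B =
      (\<integral>\<^sup>+y. (\<integral>\<^sup>+x. indicator A (f x + y) \<partial>lborel) * indicator B y \<partial>lborel)"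
    by (simp add: image_A nn_integral_cmult_indicator)
  also have "\<dots> = (\<integral>\<^sup>+y. (\<integral>\<^sup>+x. indicator A (f x + y) * indicator B y \<partial>lborel) \<partial>lborel)"
    by (simp add: nn_integral_multc)
  also have "\<dots> = (\<integral>\<^sup>+x. (\<integral>\<^sup>+y. indicator A (f x + y) * indicator B y \<partial>lborel) \<partial>lborel)"
    by (rule lborel_pair.Fubini') measurable
  also have "\<dots> = (\<integral>\<^sup>+x. (\<integral>\<^sup>+y. indicator A y * indicator B (y - f x) \<partial>lborel) \<partial>lborel)"
    using nn_integral_lborel_translate[of "\<lambda>y. indicator A y * indicator B (y - f x)" "f x" for x]
    by (simp add: add.commute)
  also have "\<dots> = (\<integral>\<^sup>+y. (\<integral>\<^sup>+x. indicator A y * indicator B (y - f x) \<partial>lborel) \<partial>lborel)"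
    by (rule lborel_pair.Fubini') measurable
  also have "\<dots> = (\<integral>\<^sup>+y. indicator A y * (\<integral>\<^sup>+x. indicator B (- f x) \<partial>lborel) \<partial>lborel)"
    by (simp add: nn_integral_cmult image_B)
  also have "\<dots> = emeasure lborel A * (\<integral>\<^sup>+x. indicator B (- f x) \<partial>lborel)"
    by (simp add: nn_integral_multc)
  finally show ?thesis .
qed

lemma distr_lborel_isometry:
  fixes f :: "'a::euclidean_space \<Rightarrow> 'a"
  assumes lin: "linear f" and iso: "\<And>x. norm (f x) = norm x"
  shows "distr lborel borel f = lborel"
proof (rule measure_eqI)
  fix A assume "A \<in> sets (distr lborel borel f)"
  then have A: "A \<in> sets borel" by simp
  have "inj f"
    using iso by (auto simp: linear_injective_0[OF lin]) (metis norm_eq_zero)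
  then have "surj f" using linear_injective_imp_surjective[OF lin] by simp
  have "indicator (ball 0 1) (- f x) = (indicator (ball 0 1) x :: ennreal)" for x
    by (simp add: indicator_def iso)
  then have "emeasure (distr lborel borel f) A * emeasure lborel (ball (0 :: 'a) 1) =
      emeasure lborel A * emeasure lborel (ball (0 :: 'a) 1)"
    using emeasure_distr_lborel_linear[OF lin \<open>surj f\<close> A, of "ball 0 1"] by simp
  then show "emeasure (distr lborel borel f) A = emeasure lborel A"
    using emeasure_lborel_open_neq_0[of "ball (0 :: 'a) 1"] emeasure_lborel_ball_finite[of "0 :: 'a" 1]
    by (auto simp: mult.commute[of _ "emeasure lborel (ball _ _)"] ennreal_mult_cancel_left)
qed simp

definition unit_cone :: "'a::euclidean_space set \<Rightarrow> 'a set" where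
  "unit_cone A = sgn -` A \<inter> (cball 0 1 - {0})"

lemma sets_sphere_area:
  "sets (sphere_area :: 'a::euclidean_space measure) = sets (restrict_space borel (sphere 0 1))"
  by (simp add: sphere_area_def)

lemma sets_uniform_sphere [measurable_cong]:
    "sets (uniform_sphere :: 'a::euclidean_space measure) = sets (restrict_space borel (sphere 0 1))"
  and space_uniform_sphere [simp]: "space (uniform_sphere :: 'a measure) = sphere 0 1"
  by (simp_all add: uniform_sphere_def sphere_area_def space_restrict_space space_scale_measure)

lemma measurable_uniform_sphereI:
  assumes "f \<in> borel_measurable N" "\<And>x. x \<in> space N \<Longrightarrow> norm (f x) = 1"
  shows "f \<in> N \<rightarrow>\<^sub>M uniform_sphere"
  unfolding measurable_cong_sets[OF refl sets_uniform_sphere]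
  using assms by (intro measurable_restrict_space2) auto

lemma measurable_from_uniform_sphere: "f \<in> borel \<rightarrow>\<^sub>M N \<Longrightarrow> f \<in> uniform_sphere \<rightarrow>\<^sub>M N"
  unfolding measurable_cong_sets[OF sets_uniform_sphere refl] by (rule measurable_restrict_space1)

lemma sgn_measurable_sphere:
  "(sgn :: 'a::euclidean_space \<Rightarrow> 'a) \<in>
     restrict_space lborel (cball 0 1 - {0}) \<rightarrow>\<^sub>M restrict_space borel (sphere 0 1)"
  by (rule measurable_restrict_space2)
     (auto simp: space_restrict_space norm_sgn sgn_div_norm intro!: measurable_restrict_space1)

lemma unit_cone_borel:
  assumes "A \<in> sets uniform_sphere"
  shows "unit_cone A \<in> sets borel"
proof -
  have "unit_cone A \<in> sets (restrict_space lborel (cball 0 1 - {0}))"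
    using measurable_sets[OF sgn_measurable_sphere, of A] assms
    by (simp add: unit_cone_def sets_uniform_sphere space_restrict_space)
  then show ?thesis by (simp add: sets_restrict_space_iff)
qed

lemma emeasure_sphere_area:
  assumes "A \<in> sets (uniform_sphere :: 'a::euclidean_space measure)"
  shows "emeasure sphere_area A = of_nat DIM('a) * emeasure lborel (unit_cone A)"
  unfolding sphere_area_def using assms
  by (simp add: emeasure_distr[OF sgn_measurable_sphere] space_restrict_space emeasure_restrict_space
      unit_cone_def sets_uniform_sphere)

lemma emeasure_sphere_area_sphere:
  "emeasure (sphere_area :: 'a::euclidean_space measure) (sphere 0 1) \<noteq> 0"
  "emeasure (sphere_area :: 'a::euclidean_space measure) (sphere 0 1) \<noteq> \<infinity>"
proof -
  have "sphere 0 1 \<in> sets (uniform_sphere :: 'a measure)"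
    using sets.top[of "uniform_sphere :: 'a measure"] by simp
  moreover have "unit_cone (sphere 0 1) = cball (0 :: 'a) 1 - {0}"
    by (auto simp: unit_cone_def norm_sgn)
  moreover have "emeasure lborel (cball (0 :: 'a) 1 - {0}) = emeasure lborel (cball (0 :: 'a) 1)"
    by (subst emeasure_Diff) auto
  ultimately have "emeasure (sphere_area :: 'a measure) (sphere 0 1) =
      of_nat DIM('a) * emeasure lborel (cball (0 :: 'a) 1)"
    by (simp add: emeasure_sphere_area)
  moreover have "emeasure lborel (cball (0 :: 'a) 1) \<noteq> 0"
    using emeasure_lborel_open_neq_0[of "ball (0 :: 'a) 1"]
      emeasure_mono[OF ball_subset_cball, of "0 :: 'a" 1 lborel] by auto
  moreover have "emeasure lborel (cball (0 :: 'a) 1) < \<infinity>"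
    by (rule emeasure_lborel_cball_finite)
  ultimately show "emeasure (sphere_area :: 'a measure) (sphere 0 1) \<noteq> 0"
    "emeasure (sphere_area :: 'a measure) (sphere 0 1) \<noteq> \<infinity>"
    by (auto simp: ennreal_mult_eq_top_iff)
qed

lemma prob_space_uniform_sphere: "prob_space (uniform_sphere :: 'a::euclidean_space measure)"
  unfolding uniform_sphere_def using emeasure_sphere_area_sphere by (rule prob_space_uniform_measure)

global_interpretation sphere: prob_space "uniform_sphere :: 'a::euclidean_space measure"
  by (rule prob_space_uniform_sphere)

global_interpretation sphere: compact_measure "uniform_sphere :: 'a::euclidean_space measure" "sphere 0 1"
  by unfold_locales (simp_all add: compact_sphere sets_uniform_sphere)

lemma emeasure_uniform_sphere:
  assumes "A \<in> sets (uniform_sphere :: 'a::euclidean_space measure)"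
  shows "emeasure uniform_sphere A =
    of_nat DIM('a) * emeasure lborel (unit_cone A) / emeasure (sphere_area :: 'a measure) (sphere 0 1)"
proof -
  have "sphere 0 1 \<inter> A = A" using sets.sets_into_space[OF assms] by auto
  then show ?thesis
    using assms unfolding uniform_sphere_def
    by (subst emeasure_uniform_measure)
       (auto simp: emeasure_sphere_area[of A] sets_sphere_area sets_uniform_sphere sets_restrict_space_iff)
qed

lemma isometry_measurable_uniform_sphere:
  assumes "linear f" "\<And>x. norm (f x) = norm x"
  shows "f \<in> uniform_sphere \<rightarrow>\<^sub>M uniform_sphere"
  using assms
  by (intro measurable_uniform_sphereI measurable_from_uniform_sphere linear_borel_measurable) auto

lemma distr_uniform_sphere_isometry:
  fixes f :: "'a::euclidean_space \<Rightarrow> 'a"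
  assumes lin: "linear f" and iso: "\<And>x. norm (f x) = norm x"
  shows "distr uniform_sphere uniform_sphere f = uniform_sphere"
proof (rule measure_eqI)
  note meas = isometry_measurable_uniform_sphere[OF lin iso]
  fix A :: "'a set" assume "A \<in> sets (distr uniform_sphere uniform_sphere f)"
  then have A: "A \<in> sets (uniform_sphere :: 'a measure)" by simp
  have fA: "f -` A \<inter> sphere 0 1 \<in> sets (uniform_sphere :: 'a measure)"
    using measurable_sets[OF meas A] by simp
  have "sgn (f x) = f (sgn x)" for x
    by (simp add: sgn_div_norm linear_scale[OF lin] iso)
  moreover have "f x = 0 \<longleftrightarrow> x = 0" for x
    by (metis iso norm_eq_zero)
  ultimately have "unit_cone (f -` A \<inter> sphere 0 1) = f -` unit_cone A"
    by (auto simp: unit_cone_def iso norm_sgn)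
  then have "emeasure lborel (unit_cone (f -` A \<inter> sphere 0 1)) = emeasure (distr lborel borel f) (unit_cone A)"
    using unit_cone_borel[OF A] linear_borel_measurable[OF lin] by (simp add: emeasure_distr)
  also have "\<dots> = emeasure lborel (unit_cone A)"
    by (simp add: distr_lborel_isometry[OF lin iso])
  finally show "emeasure (distr uniform_sphere uniform_sphere f) A = emeasure uniform_sphere A"
    using A fA by (simp add: emeasure_distr[OF meas] emeasure_uniform_sphere)
qed simp

lemma integral_uniform_sphere_isometry:
  fixes f :: "'a::euclidean_space \<Rightarrow> 'a" and g :: "'a \<Rightarrow> real"
  assumes "linear f" "\<And>x. norm (f x) = norm x" "g \<in> borel_measurable uniform_sphere"
  shows "(LINT x|uniform_sphere. g (f x)) = (LINT x|uniform_sphere. g x)"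
  using integral_distr[OF isometry_measurable_uniform_sphere[OF assms(1,2)] assms(3)]
  by (simp add: distr_uniform_sphere_isometry[OF assms(1,2)])

lemma emeasure_uniform_sphere_open:
  fixes U :: "'a::euclidean_space set"
  assumes U: "open U" "x \<in> U" "norm x = 1"
  shows "emeasure uniform_sphere (U \<inter> sphere 0 1) \<noteq> 0"
proof -
  have A: "U \<inter> sphere 0 1 \<in> sets (uniform_sphere :: 'a measure)"
    using U by (simp add: sets_uniform_sphere sets_restrict_space_iff)
  let ?V = "sgn -` U \<inter> (ball 0 1 - {0 :: 'a})"
  have "continuous_on (ball 0 1 - {0 :: 'a}) sgn"
    by (intro continuous_intros) auto
  then have "open ?V"
    using U(1) by (subst Int_commute) (intro continuous_open_preimage, auto)
  moreover have "(1/2) *\<^sub>R x \<in> ?V" using U by (auto simp: sgn_div_norm)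
  ultimately have "emeasure lborel ?V \<noteq> 0"
    by (intro emeasure_lborel_open_neq_0) auto
  moreover have "emeasure lborel ?V \<le> emeasure lborel (unit_cone (U \<inter> sphere 0 1))"
    using unit_cone_borel[OF A] by (intro emeasure_mono) (auto simp: unit_cone_def norm_sgn)
  ultimately have "emeasure lborel (unit_cone (U \<inter> sphere 0 1)) \<noteq> 0" by auto
  then show ?thesis
    using emeasure_sphere_area_sphere(2)
    by (simp add: emeasure_uniform_sphere[OF A] ennreal_divide_eq_0_iff)
qed

lemma integral_uniform_sphere_pos:
  fixes f :: "'a::euclidean_space \<Rightarrow> real"
  assumes f: "continuous_on UNIV f" and nonneg: "\<And>x. f x \<ge> 0" and pos: "norm x = 1" "f x > 0"
  shows "(LINT x|uniform_sphere. f x) > 0"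
proof -
  have int: "integrable uniform_sphere f"
    using continuous_on_subset[OF f] by (intro sphere.L2_real_integrable sphere.continuous_on_L2_real) auto
  have "open {y. f y > 0}" using f by (intro open_Collect_less continuous_intros)
  then have "emeasure uniform_sphere ({y. f y > 0} \<inter> sphere 0 1) \<noteq> 0"
    using pos by (intro emeasure_uniform_sphere_open) auto
  moreover have "{y \<in> space uniform_sphere. f y \<noteq> 0} = {y. f y > 0} \<inter> sphere 0 1"
    using nonneg by (auto simp: order_less_le)
  moreover have "{y. f y > 0} \<inter> sphere 0 1 \<in> sets uniform_sphere"
    using \<open>open {y. f y > 0}\<close> by (simp add: sets_uniform_sphere sets_restrict_space_iff)
  ultimately have "\<not> (AE y in uniform_sphere. f y = 0)"
    by (simp add: AE_iff_measurable)
  then have "(LINT x|uniform_sphere. f x) \<noteq> 0"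
    using integral_nonneg_eq_0_iff_AE[OF int] nonneg by simp
  moreover have "(LINT x|uniform_sphere. f x) \<ge> 0" using nonneg by simp
  ultimately show ?thesis by linarith
qed

lemma variance_uniform_sphere_pos:
  fixes f :: "'a::euclidean_space \<Rightarrow> real"
  assumes f: "continuous_on UNIV f" and xy: "norm x = 1" "norm y = 1" "f x \<noteq> f y"
  shows "sphere.variance f > 0"
proof -
  obtain z where "norm z = 1" "f z \<noteq> sphere.expectation f" using xy by metis
  then show ?thesis
    using f by (intro integral_uniform_sphere_pos[of _ z]) (auto intro!: continuous_intros)
qed

section \<open>Unitary matrices over the real or complex numbers\<close>

lemma norm_vec_square: "(norm (x :: 'a::euclidean_space ^ 'n))\<^sup>2 = (\<Sum>k\<in>UNIV. (norm (x $ k))\<^sup>2)"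
  by (simp add: power2_norm_eq_inner inner_vec_def)

locale conj_field =
  fixes cj :: "'a::{real_normed_field,euclidean_space} \<Rightarrow> 'a"
  assumes cj_add: "cj (x + y) = cj x + cj y"
    and cj_mult: "cj (x * y) = cj x * cj y"
    and cj_cj [simp]: "cj (cj x) = x"
    and cj_self: "cj x * x = of_real ((norm x)\<^sup>2)"
    and inner_cj: "x \<bullet> y = 1 \<bullet> (cj x * y)"
begin

lemma cj_0 [simp]: "cj 0 = 0"
  using cj_add[of 0 0] by simp

lemma cj_eq_0_iff [simp]: "cj x = 0 \<longleftrightarrow> x = 0"
  by (metis cj_0 cj_cj)

lemma cj_of_real [simp]: "cj (of_real r) = of_real r"
  using cj_self[of "of_real r"] by (cases "r = 0") (auto simp: power2_eq_square)

lemma cj_1 [simp]: "cj 1 = 1"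
  using cj_of_real[of 1] by simp

lemma linear_cj: "linear cj"
  by (rule linearI) (auto simp: cj_add cj_mult scaleR_conv_of_real)

lemmas cj_diff = linear_diff[OF linear_cj]
lemmas cj_sum = linear_sum[OF linear_cj]

lemma cj_divide: "cj (x / y) = cj x / cj y"
proof (cases "y = 0")
  case False
  then show ?thesis using cj_mult[of "x / y" y] by (simp add: field_simps)
qed simp

lemma continuous_on_cj [continuous_intros]: "continuous_on A f \<Longrightarrow> continuous_on A (\<lambda>x. cj (f x))"
  using linear_continuous_on[OF linear_conv_bounded_linear[THEN iffD1, OF linear_cj]]
  by (rule continuous_on_compose2[where g = cj]) auto

lemma norm_cj [simp]: "norm (cj x) = norm x"
  using arg_cong[OF cj_self[of x], of norm] by (cases "x = 0") (auto simp: norm_mult power2_eq_square)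

definition hinner :: "'a ^ 'n \<Rightarrow> 'a ^ 'n \<Rightarrow> 'a" where
  "hinner x y = (\<Sum>k\<in>UNIV. cj (x $ k) * y $ k)"

lemma inner_hinner: "x \<bullet> y = 1 \<bullet> hinner x y"
  unfolding hinner_def inner_vec_def by (simp add: inner_sum_right inner_cj[symmetric])

lemma hinner_self: "hinner x x = of_real ((norm x)\<^sup>2)"
proof -
  have "hinner x x = of_real (\<Sum>k\<in>UNIV. (norm (x $ k))\<^sup>2)"
    by (simp add: hinner_def cj_self)
  then show ?thesis by (simp only: norm_vec_square)
qed

lemma norm_eq_1_iff_hinner: "norm x = 1 \<longleftrightarrow> hinner x x = 1"
proof -
  have "hinner x x = 1 \<longleftrightarrow> (of_real ((norm x)\<^sup>2) :: 'a) = of_real 1"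
    by (simp only: hinner_self of_real_1)
  then show ?thesis by (simp only: of_real_eq_iff abs_square_eq_1 abs_norm_cancel)
qed

lemma hinner_commute: "cj (hinner x y) = hinner y x"
  by (simp add: hinner_def cj_sum cj_mult mult.commute)

lemma hinner_eq_0_commute: "hinner x y = 0 \<longleftrightarrow> hinner y x = 0"
  by (metis cj_0 hinner_commute)

lemma hinner_diff_right: "hinner x (y - z) = hinner x y - hinner x z"
  and hinner_smult_right: "hinner x (c *s y) = c * hinner x y"
  and hinner_diff_left: "hinner (x - w) y = hinner x y - hinner w y"
  by (simp_all add: hinner_def sum_subtractf sum_distrib_left algebra_simps cj_diff)

lemma hinner_scaleR_right: "hinner x (r *\<^sub>R y) = r *\<^sub>R hinner x y"
  and hinner_scaleR_left: "hinner (r *\<^sub>R x) y = r *\<^sub>R hinner x y"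
  by (simp_all add: hinner_def scaleR_sum_right linear_scale[OF linear_cj])

lemma hinner_axis [simp]: "hinner (axis k 1) x = x $ k"
  by (simp add: hinner_def axis_def if_distrib[where f = cj] if_distribR cong: if_cong)
     (simp add: if_distrib[where f = "\<lambda>c. c * _"] cong: if_cong)

lemma norm_hinner_axis_right [simp]: "norm (hinner x (axis k 1)) = norm (x $ k)"
  by (metis hinner_axis hinner_commute norm_cj)

lemma norm_axis_1 [simp]: "norm (axis k 1 :: 'a ^ 'n) = 1"
  unfolding norm_eq_1_iff_hinner hinner_axis by simp

lemma continuous_on_hinner [continuous_intros]:
  "continuous_on A f \<Longrightarrow> continuous_on A g \<Longrightarrow> continuous_on A (\<lambda>x. hinner (f x) (g x))"
  unfolding hinner_def by (intro continuous_intros)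

lemma unit_directionE:
  fixes w e :: "'a ^ 'n"
  assumes "norm e = 1"
  obtains v where "norm v = 1" "w = norm w *\<^sub>R v"
    "\<And>y. hinner y w = 0 \<Longrightarrow> hinner y e = 0 \<Longrightarrow> hinner y v = 0"
proof (cases "w = 0")
  case True
  then show ?thesis using assms that[of e] by simp
next
  case False
  then show ?thesis using that[of "w /\<^sub>R norm w"] by (simp add: hinner_scaleR_right)
qed

definition adj :: "'a ^ 'n ^ 'm \<Rightarrow> 'a ^ 'm ^ 'n" where
  "adj A = (\<chi> i j. cj (A $ j $ i))"

lemma adj_adj [simp]: "adj (adj A) = A"
  by (simp add: adj_def vec_eq_iff)

lemma adj_mult: "adj (A ** B) = adj B ** adj A"
  by (simp add: adj_def matrix_matrix_mult_def vec_eq_iff cj_sum cj_mult mult.commute)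

lemma adj_mat_1: "adj (mat 1) = mat 1"
  by (simp add: adj_def mat_def vec_eq_iff)

lemma continuous_on_adj [continuous_intros]: "continuous_on A f \<Longrightarrow> continuous_on A (\<lambda>x. adj (f x))"
  unfolding adj_def by (intro continuous_intros)

lemma hinner_adj: "hinner (A *v x) y = hinner x (adj A *v y)"
proof -
  have "hinner (A *v x) y = (\<Sum>k\<in>UNIV. \<Sum>l\<in>UNIV. cj (A $ k $ l) * cj (x $ l) * y $ k)"
    by (simp add: hinner_def matrix_vector_mult_def cj_sum cj_mult sum_distrib_right)
  also have "\<dots> = (\<Sum>l\<in>UNIV. \<Sum>k\<in>UNIV. cj (A $ k $ l) * cj (x $ l) * y $ k)"
    by (rule sum.swap)
  also have "\<dots> = hinner x (adj A *v y)"
    by (simp add: hinner_def matrix_vector_mult_def adj_def sum_distrib_left mult_ac)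
  finally show ?thesis .
qed

definition unitaries :: "('a ^ 'n ^ 'n) set" where
  "unitaries = {A. adj A ** A = mat 1 \<and> A ** adj A = mat 1}"

lemma unitariesD: "A \<in> unitaries \<Longrightarrow> adj A ** A = mat 1" "A \<in> unitaries \<Longrightarrow> A ** adj A = mat 1"
  by (auto simp: unitaries_def)

lemma unitaries_mat_1: "mat 1 \<in> unitaries"
  by (simp add: unitaries_def adj_mat_1)

lemma unitaries_mult:
  assumes A: "A \<in> unitaries" and B: "B \<in> unitaries"
  shows "A ** B \<in> unitaries"
proof -
  have "adj (A ** B) ** (A ** B) = adj B ** ((adj A ** A) ** B)"
    by (simp add: adj_mult matrix_mul_assoc)
  moreover have "(A ** B) ** adj (A ** B) = A ** ((B ** adj B) ** adj A)"
    by (simp add: adj_mult matrix_mul_assoc)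
  ultimately show ?thesis by (simp add: unitariesD[OF A] unitariesD[OF B] unitaries_def)
qed

lemma unitaries_adj: "A \<in> unitaries \<Longrightarrow> adj A \<in> unitaries"
  by (auto simp: unitaries_def)

lemma hinner_unitary: "A \<in> unitaries \<Longrightarrow> hinner (A *v x) (A *v y) = hinner x y"
  by (simp add: hinner_adj matrix_vector_mul_assoc unitariesD)

lemma norm_unitary: "A \<in> unitaries \<Longrightarrow> norm (A *v x) = norm x"
  using hinner_unitary[of A x x] by (simp add: hinner_self del: of_real_power)

text \<open>
  The reflection along \<open>w\<close> has \<open>t = hinner w w / 2\<close>. Over the complex numbers, mapping a unit vector
  \<open>u\<close> to a unit vector \<open>u - w\<close> requires \<open>t = hinner w u\<close>, whose real part only is \<open>hinner w w / 2\<close>.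
\<close>

definition reflection :: "'a ^ 'n \<Rightarrow> 'a \<Rightarrow> 'a ^ 'n ^ 'n" where
  "reflection w t = (\<chi> k l. (if k = l then 1 else 0) - w $ k * cj (w $ l) / t)"

lemma reflection_mult: "reflection w t *v x = x - (hinner w x / t) *s w"
proof -
  have "(reflection w t *v x) $ k = x $ k - hinner w x / t * w $ k" for k
  proof -
    have "(reflection w t *v x) $ k =
        (\<Sum>l\<in>UNIV. (if k = l then x $ l else 0) - w $ k / t * (cj (w $ l) * x $ l))"
      unfolding matrix_vector_mult_def reflection_def
      by (simp, intro sum.cong) (auto simp: algebra_simps)
    also have "\<dots> = x $ k - w $ k / t * hinner w x"
      by (simp add: sum_subtractf hinner_def sum_distrib_left)
    finally show ?thesis by (simp add: mult.commute)
  qed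
  then show ?thesis by (simp add: vec_eq_iff)
qed

lemma adj_reflection: "adj (reflection w t) = reflection w (cj t)"
  by (simp add: adj_def reflection_def vec_eq_iff cj_diff cj_mult cj_divide mult.commute)

lemma reflection_unitary:
  assumes t: "t + cj t = hinner w w" and "t \<noteq> 0"
  shows "reflection w t \<in> unitaries"
proof -
  have inverse: "reflection w s *v (reflection w (cj s) *v x) = x"
    if s: "s + cj s = hinner w w" "s \<noteq> 0" for s x
  proof -
    have "hinner w (reflection w (cj s) *v x) = - (hinner w x / cj s) * s"
      using s(2) by (simp add: reflection_mult hinner_diff_right hinner_smult_right distrib_left flip: s(1))
    then show ?thesis
      using s(2) by (simp add: reflection_mult[of w s] vec_eq_iff) (simp add: reflection_mult)
  qed
  show ?thesis
    using inverse[of t] inverse[of "cj t"] t \<open>t \<noteq> 0\<close>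
    by (simp add: unitaries_def adj_reflection matrix_eq add.commute flip: matrix_vector_mul_assoc)
qed

lemma unitaries_transitive:
  fixes u v :: "'a ^ 'n"
  assumes u: "norm u = 1" and v: "norm v = 1"
  obtains h where "h \<in> unitaries" "h *v u = v" "\<And>y. hinner u y = 0 \<Longrightarrow> hinner v y = 0 \<Longrightarrow> h *v y = y"
proof (cases "u = v")
  case True
  then show ?thesis using that[of "mat 1"] by (simp add: unitaries_mat_1)
next
  case False
  define w where "w = u - v"
  define t where "t = hinner w u"
  have t: "t + cj t = hinner w w"
    using u v
    by (simp add: t_def w_def hinner_diff_left hinner_diff_right cj_diff hinner_commute
        hinner_self[of u] hinner_self[of v])
  have "t \<noteq> 0"
  proof
    assume "t = 0"
    then show False using t False by (simp add: hinner_self w_def)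
  qed
  show ?thesis
  proof (rule that)
    show "reflection w t \<in> unitaries" using t \<open>t \<noteq> 0\<close> by (rule reflection_unitary)
    show "reflection w t *v u = v"
      using \<open>t \<noteq> 0\<close> by (simp add: reflection_mult flip: t_def) (simp add: w_def)
    show "reflection w t *v y = y" if "hinner u y = 0" "hinner v y = 0" for y
      using that by (simp add: reflection_mult w_def hinner_diff_left)
  qed
qed

lemma unitaries_transitive_pairs:
  fixes u v u' v' :: "'a ^ 'n"
  assumes u: "norm u = 1" "norm v = 1" "hinner u v = 0"
    and u': "norm u' = 1" "norm v' = 1" "hinner u' v' = 0"
  obtains h where "h \<in> unitaries" "h *v u = u'" "h *v v = v'"
proof -
  obtain g where g: "g \<in> unitaries" "g *v u = u'"
    using unitaries_transitive[OF u(1) u'(1)] by blast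
  have "hinner u' (g *v v) = 0"
    using hinner_unitary[OF g(1), of u v] g(2) u(3) by simp
  then have orth: "hinner (g *v v) u' = 0" "hinner v' u' = 0"
    using u'(3) by (simp_all add: hinner_eq_0_commute[of _ u'])
  obtain h where h: "h \<in> unitaries" "h *v (g *v v) = v'" "h *v u' = u'"
    using unitaries_transitive[of "g *v v" v'] norm_unitary[OF g(1), of v] u(2) u'(2) orth by metis
  show thesis
    using that[of "h ** g"] g h by (simp add: unitaries_mult flip: matrix_vector_mul_assoc)
qed

definition erase :: "'n \<Rightarrow> 'a ^ 'n \<Rightarrow> 'a ^ 'n" where
  "erase j x = (\<chi> k. if k = j then 0 else x $ k)"

lemma hinner_erase: "hinner (erase j w) x = hinner w (erase j x)"
  unfolding hinner_def by (intro sum.cong) (auto simp: erase_def)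

lemma norm_erase_sum: "(norm (erase j x))\<^sup>2 = (\<Sum>k\<in>UNIV - {j}. (norm (x $ k))\<^sup>2)"
proof -
  have "(norm (erase j x))\<^sup>2 = (\<Sum>k\<in>UNIV. if k = j then 0 else (norm (x $ k))\<^sup>2)"
    unfolding norm_vec_square by (intro sum.cong) (auto simp: erase_def)
  also have "\<dots> = (\<Sum>k\<in>UNIV - {j}. (norm (x $ k))\<^sup>2)"
    by (intro sum.mono_neutral_cong_right) auto
  finally show ?thesis .
qed

lemma norm_erase: "(norm (erase j x))\<^sup>2 = (norm x)\<^sup>2 - (norm (x $ j))\<^sup>2"
  by (simp add: norm_erase_sum norm_vec_square[of x] sum_diff1)

lemma norm_erase_le: "norm (erase j x) \<le> norm x"
  by (rule power2_le_imp_le) (simp_all add: norm_erase)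

lemma norm_erase_adj:
  assumes "R \<in> unitaries"
  shows "(norm (erase j (adj R *v a)))\<^sup>2 = (norm a)\<^sup>2 - (norm (hinner a (R *v axis j 1)))\<^sup>2"
proof -
  have "norm ((adj R *v a) $ j) = norm (hinner (adj R *v a) (axis j 1))" by simp
  also have "\<dots> = norm (hinner a (R *v axis j 1))" by (simp add: hinner_adj)
  finally show ?thesis using norm_unitary[OF unitaries_adj[OF assms], of a] by (simp add: norm_erase)
qed

lemma continuous_on_erase [continuous_intros]:
  assumes "continuous_on A f"
  shows "continuous_on A (\<lambda>x. erase j (f x))"
  unfolding erase_def
proof (intro continuous_on_vec_lambda)
  show "continuous_on A (\<lambda>x. if k = j then 0 else f x $ k)" for k
    using assms by (cases "k = j") (auto intro!: continuous_intros)
qed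

end

lemma conj_field_real: "conj_field (\<lambda>x :: real. x)"
  by unfold_locales (simp_all add: power2_eq_square)

lemma conj_field_cnj: "conj_field cnj"
  by unfold_locales (simp_all add: complex_norm_square mult.commute inner_complex_def del: of_real_power)

lemma hinner_real: "conj_field.hinner (\<lambda>x :: real. x) = inner"
  by (simp add: fun_eq_iff conj_field.hinner_def[OF conj_field_real] inner_vec_def)

lemma unitaries_real: "conj_field.unitaries (\<lambda>x :: real. x) = orthogonal_group"
  by (simp add: conj_field.unitaries_def[OF conj_field_real] conj_field.adj_def[OF conj_field_real]
      orthogonal_group_def orthogonal_matrix_def transpose_def)

lemma hinner_cnj: "conj_field.hinner cnj = cinner_vec"
  by (simp add: fun_eq_iff conj_field.hinner_def[OF conj_field_cnj] cinner_vec_def)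

lemma unitaries_cnj: "conj_field.unitaries cnj = unitary_group"
  by (simp add: conj_field.unitaries_def[OF conj_field_cnj] conj_field.adj_def[OF conj_field_cnj]
      unitary_group_def unitary_matrix_def adjoint_matrix_def)

section \<open>Haar measure\<close>

lemma borel_measurable_matrix_mult:
  fixes f :: "'b \<Rightarrow> 'a::{real_normed_field,euclidean_space} ^ 'n ^ 'm" and g :: "'b \<Rightarrow> 'a ^ 'k ^ 'n"
  assumes "f \<in> borel_measurable M" "g \<in> borel_measurable M"
  shows "(\<lambda>x. f x ** g x) \<in> borel_measurable M"
  using assms unfolding matrix_matrix_mult_def
  by (rule borel_measurable_continuous_Pair) (intro continuous_intros)

lemma borel_measurable_matrix_vector_mult:
  fixes f :: "'b \<Rightarrow> 'a::{real_normed_field,euclidean_space} ^ 'n ^ 'm" and g :: "'b \<Rightarrow> 'a ^ 'n"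
  assumes "f \<in> borel_measurable M" "g \<in> borel_measurable M"
  shows "(\<lambda>x. f x *v g x) \<in> borel_measurable M"
  using assms unfolding matrix_vector_mult_def
  by (rule borel_measurable_continuous_Pair) (intro continuous_intros)

locale haar_group = conj_field cj for cj :: "'a::{real_normed_field,euclidean_space} \<Rightarrow> 'a" +
  fixes \<mu> :: "('a ^ 'n::finite ^ 'n) measure"
  assumes haar: "normalized_haar unitaries \<mu>"
begin

sublocale prob_space \<mu>
  using haar by (simp add: normalized_haar_def)

sublocale haar_pair: pair_prob_space \<mu> \<mu> ..

sublocale sphere_pair: pair_prob_space \<mu> "uniform_sphere :: ('a ^ 'n) measure" ..

lemma sets_haar [measurable_cong]: "sets \<mu> = sets (restrict_space borel unitaries)"
  using haar by (simp add: normalized_haar_def)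

lemma space_haar [simp]: "space \<mu> = unitaries"
  using sets_eq_imp_space_eq[OF sets_haar] by (simp add: space_restrict_space)

lemma measurable_haarI:
  assumes "f \<in> borel_measurable N" "\<And>x. x \<in> space N \<Longrightarrow> f x \<in> unitaries"
  shows "f \<in> N \<rightarrow>\<^sub>M \<mu>"
  unfolding measurable_cong_sets[OF refl sets_haar]
  using assms by (intro measurable_restrict_space2) auto

lemma measurable_from_haar: "f \<in> borel \<rightarrow>\<^sub>M N \<Longrightarrow> f \<in> \<mu> \<rightarrow>\<^sub>M N"
  unfolding measurable_cong_sets[OF sets_haar refl] by (rule measurable_restrict_space1)

lemma measurable_haar_borel: "f \<in> N \<rightarrow>\<^sub>M \<mu> \<Longrightarrow> f \<in> borel_measurable N"
  using measurable_compose[OF _ measurable_from_haar[OF measurable_ident]] by (simp add: id_def)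

lemma measurable_haar_mult [measurable (raw)]:
  assumes "f \<in> N \<rightarrow>\<^sub>M \<mu>" "g \<in> N \<rightarrow>\<^sub>M \<mu>"
  shows "(\<lambda>x. f x ** g x) \<in> N \<rightarrow>\<^sub>M \<mu>"
proof (rule measurable_haarI)
  show "(\<lambda>x. f x ** g x) \<in> borel_measurable N"
    using assms by (intro borel_measurable_matrix_mult measurable_haar_borel)
  show "f x ** g x \<in> unitaries" if "x \<in> space N" for x
    using measurable_space[OF assms(1) that] measurable_space[OF assms(2) that]
    by (simp add: unitaries_mult)
qed

lemma measurable_haar_adj [measurable (raw)]:
  assumes "f \<in> N \<rightarrow>\<^sub>M \<mu>"
  shows "(\<lambda>x. adj (f x)) \<in> N \<rightarrow>\<^sub>M \<mu>"
proof (rule measurable_haarI)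
  have "adj \<in> borel_measurable (borel :: ('a ^ 'n ^ 'n) measure)"
    by (intro borel_measurable_continuous_onI continuous_intros)
  then show "(\<lambda>x. adj (f x)) \<in> borel_measurable N"
    by (rule measurable_compose[OF measurable_haar_borel[OF assms]])
  show "adj (f x) \<in> unitaries" if "x \<in> space N" for x
    using measurable_space[OF assms that] by (simp add: unitaries_adj)
qed

lemma measurable_haar_action [measurable (raw)]:
  assumes "f \<in> N \<rightarrow>\<^sub>M \<mu>" "g \<in> N \<rightarrow>\<^sub>M uniform_sphere"
  shows "(\<lambda>x. f x *v g x) \<in> N \<rightarrow>\<^sub>M uniform_sphere"
proof (rule measurable_uniform_sphereI)
  have "g \<in> borel_measurable N"
    using measurable_compose[OF assms(2) measurable_from_uniform_sphere[OF measurable_ident]]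
    by (simp add: id_def)
  then show "(\<lambda>x. f x *v g x) \<in> borel_measurable N"
    by (rule borel_measurable_matrix_vector_mult[OF measurable_haar_borel[OF assms(1)]])
  show "norm (f x *v g x) = 1" if "x \<in> space N" for x
    using measurable_space[OF assms(1) that] measurable_space[OF assms(2) that]
    by (simp add: norm_unitary)
qed

lemma measurable_haar_mult_right: "h \<in> unitaries \<Longrightarrow> (\<lambda>R. R ** h) \<in> \<mu> \<rightarrow>\<^sub>M \<mu>"
  and measurable_haar_orbit: "norm e = 1 \<Longrightarrow> (\<lambda>R. R *v e) \<in> \<mu> \<rightarrow>\<^sub>M uniform_sphere"
  by (auto intro!: measurable_haar_mult measurable_haar_action)

lemma distr_haar_left:
  assumes g: "g \<in> unitaries"
  shows "distr \<mu> \<mu> (\<lambda>R. g ** R) = \<mu>"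
proof (rule measure_eqI)
  have [measurable]: "(\<lambda>_. g) \<in> \<mu> \<rightarrow>\<^sub>M \<mu>" using g by simp
  fix A assume "A \<in> sets (distr \<mu> \<mu> (\<lambda>R. g ** R))"
  then have A: "A \<in> sets \<mu>" by simp
  then have "A \<subseteq> unitaries" using sets.sets_into_space by fastforce
  have "(\<lambda>R. g ** R) -` A \<inter> unitaries = (\<lambda>R. adj g ** R) ` A"
  proof (intro equalityI subsetI)
    fix R assume "R \<in> (\<lambda>R. g ** R) -` A \<inter> unitaries"
    then show "R \<in> (\<lambda>R. adj g ** R) ` A"
      using g by (intro image_eqI[of _ _ "g ** R"]) (auto simp: matrix_mul_assoc unitariesD)
  next
    fix R assume "R \<in> (\<lambda>R. adj g ** R) ` A"
    then obtain Q where "Q \<in> A" "R = adj g ** Q" by auto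
    then show "R \<in> (\<lambda>R. g ** R) -` A \<inter> unitaries"
      using g \<open>A \<subseteq> unitaries\<close> by (auto simp: matrix_mul_assoc unitariesD unitaries_mult unitaries_adj)
  qed
  then show "emeasure (distr \<mu> \<mu> (\<lambda>R. g ** R)) A = emeasure \<mu> A"
    using haar A unitaries_adj[OF g] by (simp add: emeasure_distr normalized_haar_def)
qed simp

lemma nn_integral_haar_left:
  assumes g: "g \<in> unitaries" and f: "f \<in> borel_measurable \<mu>"
  shows "(\<integral>\<^sup>+R. f (g ** R) \<partial>\<mu>) = (\<integral>\<^sup>+R. f R \<partial>\<mu>)"
proof -
  have "(\<lambda>R. g ** R) \<in> \<mu> \<rightarrow>\<^sub>M \<mu>" using g by (auto intro!: measurable_haar_mult)
  then show ?thesis using nn_integral_distr[of "(**) g" \<mu> \<mu> f] f by (simp add: distr_haar_left[OF g])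
qed

text \<open>
  Unimodularity of a compact group: integrate \<open>f (x\<^sup>-\<^sup>1 y)\<close> over \<open>x\<close> and \<open>y\<close> in both orders.
\<close>

lemma distr_haar_adj: "distr \<mu> \<mu> adj = \<mu>"
proof (rule measure_eqI)
  fix A assume "A \<in> sets (distr \<mu> \<mu> adj)"
  then have [measurable]: "A \<in> sets \<mu>" by simp
  have inner_y: "(\<integral>\<^sup>+y. indicator A (adj x ** y) \<partial>\<mu>) = emeasure \<mu> A" if "x \<in> unitaries" for x
    using nn_integral_haar_left[OF unitaries_adj[OF that], of "indicator A"] by simp
  have inner_x: "(\<integral>\<^sup>+x. indicator A (adj x ** y) \<partial>\<mu>) = emeasure (distr \<mu> \<mu> adj) A" if "y \<in> unitaries" for y
  proof -
    have "(\<integral>\<^sup>+x. indicator A (adj x ** y) \<partial>\<mu>) = (\<integral>\<^sup>+x. indicator A (adj (adj y ** x)) \<partial>\<mu>)"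
      by (simp add: adj_mult)
    also have "\<dots> = (\<integral>\<^sup>+x. indicator A (adj x) \<partial>\<mu>)"
      by (rule nn_integral_haar_left[OF unitaries_adj[OF that]]) measurable
    also have "\<dots> = (\<integral>\<^sup>+x. indicator A x \<partial>distr \<mu> \<mu> adj)"
      by (rule nn_integral_distr[symmetric]) measurable
    finally show ?thesis by simp
  qed
  have "emeasure \<mu> A = (\<integral>\<^sup>+x. \<integral>\<^sup>+y. indicator A (adj x ** y) \<partial>\<mu> \<partial>\<mu>)"
  proof -
    have "(\<integral>\<^sup>+x. \<integral>\<^sup>+y. indicator A (adj x ** y) \<partial>\<mu> \<partial>\<mu>) = (\<integral>\<^sup>+x. emeasure \<mu> A \<partial>\<mu>)"
      by (rule nn_integral_cong) (simp add: inner_y)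
    then show ?thesis using emeasure_space_1 by simp
  qed
  also have "\<dots> = (\<integral>\<^sup>+y. \<integral>\<^sup>+x. indicator A (adj x ** y) \<partial>\<mu> \<partial>\<mu>)"
    by (rule haar_pair.Fubini') measurable
  also have "\<dots> = (\<integral>\<^sup>+y. emeasure (distr \<mu> \<mu> adj) A \<partial>\<mu>)"
    by (rule nn_integral_cong) (simp add: inner_x)
  also have "\<dots> = emeasure (distr \<mu> \<mu> adj) A" using emeasure_space_1 by simp
  finally show "emeasure (distr \<mu> \<mu> adj) A = emeasure \<mu> A" ..
qed simp

lemma distr_haar_right:
  assumes h: "h \<in> unitaries"
  shows "distr \<mu> \<mu> (\<lambda>R. R ** h) = \<mu>"
proof -
  have [measurable]: "(\<lambda>_. adj h) \<in> \<mu> \<rightarrow>\<^sub>M \<mu>" using unitaries_adj[OF h] by simp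
  have "\<mu> = distr (distr (distr \<mu> \<mu> adj) \<mu> (\<lambda>R. adj h ** R)) \<mu> adj"
    by (simp add: distr_haar_adj distr_haar_left unitaries_adj[OF h])
  also have "\<dots> = distr \<mu> \<mu> (\<lambda>R. R ** h)"
    by (subst distr_distr, measurable)+ (simp add: o_def adj_mult)
  finally show ?thesis ..
qed

lemma integral_haar_right:
  fixes f :: "'a ^ 'n ^ 'n \<Rightarrow> real"
  assumes h: "h \<in> unitaries" and f: "f \<in> borel_measurable \<mu>"
  shows "(LINT R|\<mu>. f (R ** h)) = (LINT R|\<mu>. f R)"
  using integral_distr[OF measurable_haar_mult_right[OF h] f] by (simp add: distr_haar_right[OF h])

lemma distr_haar_orbit_eq:
  assumes "norm x = 1" "norm e = 1"
  shows "distr \<mu> uniform_sphere (\<lambda>R. R *v x) = distr \<mu> uniform_sphere (\<lambda>R. R *v e)"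
proof -
  obtain h where h: "h \<in> unitaries" "h *v e = x" using unitaries_transitive[OF assms(2,1)] by blast
  have "distr \<mu> uniform_sphere (\<lambda>R. R *v e) = distr (distr \<mu> \<mu> (\<lambda>R. R ** h)) uniform_sphere (\<lambda>R. R *v e)"
    by (simp add: distr_haar_right[OF h(1)])
  also have "\<dots> = distr \<mu> uniform_sphere (\<lambda>R. R *v x)"
    by (subst distr_distr[OF measurable_haar_orbit[OF assms(2)] measurable_haar_mult_right[OF h(1)]])
      (simp add: o_def h(2) flip: matrix_vector_mul_assoc)
  finally show ?thesis ..
qed

lemma distr_haar_orbit:
  assumes e: "norm (e :: 'a ^ 'n) = 1"
  shows "distr \<mu> uniform_sphere (\<lambda>R. R *v e) = uniform_sphere"
proof (rule measure_eqI)
  let ?u = "uniform_sphere :: ('a ^ 'n) measure"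
  fix A assume "A \<in> sets (distr \<mu> ?u (\<lambda>R. R *v e))"
  then have [measurable]: "A \<in> sets ?u" by simp
  have inner_x: "(\<integral>\<^sup>+x. indicator A (R *v x) \<partial>?u) = emeasure ?u A" if "R \<in> unitaries" for R
  proof -
    have iso: "linear ((*v) R)" "\<And>x. norm (R *v x) = norm x" using that by (simp_all add: norm_unitary)
    have "(\<integral>\<^sup>+x. indicator A (R *v x) \<partial>?u) = (\<integral>\<^sup>+x. indicator A x \<partial>distr ?u ?u ((*v) R))"
      by (rule nn_integral_distr[OF isometry_measurable_uniform_sphere[OF iso], symmetric]) simp
    then show ?thesis by (simp add: distr_uniform_sphere_isometry[OF iso])
  qed
  have inner_R: "(\<integral>\<^sup>+R. indicator A (R *v x) \<partial>\<mu>) = emeasure (distr \<mu> ?u (\<lambda>R. R *v e)) A"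
    if "x \<in> space ?u" for x
  proof -
    have x: "norm x = 1" using that by simp
    have "(\<integral>\<^sup>+R. indicator A (R *v x) \<partial>\<mu>) = (\<integral>\<^sup>+y. indicator A y \<partial>distr \<mu> ?u (\<lambda>R. R *v x))"
      by (rule nn_integral_distr[OF measurable_haar_orbit[OF x], symmetric]) simp
    then show ?thesis by (simp add: distr_haar_orbit_eq[OF x e])
  qed
  have "emeasure ?u A = (\<integral>\<^sup>+R. \<integral>\<^sup>+x. indicator A (R *v x) \<partial>?u \<partial>\<mu>)"
  proof -
    have "(\<integral>\<^sup>+R. \<integral>\<^sup>+x. indicator A (R *v x) \<partial>?u \<partial>\<mu>) = (\<integral>\<^sup>+R. emeasure ?u A \<partial>\<mu>)"
      by (rule nn_integral_cong) (simp add: inner_x)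
    then show ?thesis using emeasure_space_1 by simp
  qed
  also have "\<dots> = (\<integral>\<^sup>+x. \<integral>\<^sup>+R. indicator A (R *v x) \<partial>\<mu> \<partial>?u)"
    by (rule sphere_pair.Fubini'[symmetric]) measurable
  also have "\<dots> = (\<integral>\<^sup>+x. emeasure (distr \<mu> ?u (\<lambda>R. R *v e)) A \<partial>?u)"
    by (rule nn_integral_cong) (rule inner_R)
  also have "\<dots> = emeasure (distr \<mu> ?u (\<lambda>R. R *v e)) A"
    using sphere.emeasure_space_1[where 'a = "'a ^ 'n"] by simp
  finally show "emeasure (distr \<mu> ?u (\<lambda>R. R *v e)) A = emeasure ?u A" ..
qed simp

lemma integral_haar_orbit:
  fixes f :: "'a ^ 'n \<Rightarrow> real"
  assumes e: "norm e = 1" and f: "f \<in> borel_measurable uniform_sphere"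
  shows "(LINT R|\<mu>. f (R *v e)) = (LINT x|uniform_sphere. f x)"
  using integral_distr[OF measurable_haar_orbit[OF e] f] distr_haar_orbit[OF e] by simp

lemma integrable_haar_orbit:
  fixes f :: "'a ^ 'n \<Rightarrow> real"
  assumes e: "norm e = 1" and f: "integrable uniform_sphere f"
  shows "integrable \<mu> (\<lambda>R. f (R *v e))"
  using integrable_distr[OF measurable_haar_orbit[OF e], of f] f distr_haar_orbit[OF e] by simp

lemma L2_haar_orbit:
  assumes e: "norm e = 1" and f: "f \<in> L2_real uniform_sphere"
  shows "(\<lambda>R. f (R *v e)) \<in> L2_real \<mu>"
  using integrable_haar_orbit[OF e L2_realD(2)[OF f]]
    measurable_compose[OF measurable_haar_orbit[OF e] L2_realD(1)[OF f]] by (simp add: L2_real_def)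

lemma integral_haar_pair:
  fixes f g :: "'a ^ 'n \<Rightarrow> real"
  assumes f: "f \<in> borel_measurable uniform_sphere" and g: "g \<in> borel_measurable uniform_sphere"
    and uv: "norm u = 1" "norm v = 1" "hinner u v = 0"
    and uv': "norm u' = 1" "norm v' = 1" "hinner u' v' = 0"
  shows "(LINT R|\<mu>. f (R *v u) * g (R *v v)) = (LINT R|\<mu>. f (R *v u') * g (R *v v'))"
proof -
  obtain h where h: "h \<in> unitaries" "h *v u' = u" "h *v v' = v"
    using unitaries_transitive_pairs[OF uv' uv] by blast
  have "(\<lambda>R. f (R *v u') * g (R *v v')) \<in> borel_measurable \<mu>"
    using uv' by (intro borel_measurable_times measurable_compose[OF measurable_haar_orbit f]
        measurable_compose[OF measurable_haar_orbit g])
  from integral_haar_right[OF h(1) this] show ?thesis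
    by (simp add: matrix_vector_mul_assoc[symmetric] h)
qed

end

section \<open>Conditional expectation given one basis vector\<close>

definition positively_homogeneous :: "nat \<Rightarrow> ('v::real_vector \<Rightarrow> real) \<Rightarrow> bool" where
  "positively_homogeneous n k \<longleftrightarrow> (\<forall>r\<ge>0. \<forall>s. k (r *\<^sub>R s) = r ^ n * k s)"

lemma positively_homogeneousD: "positively_homogeneous n k \<Longrightarrow> r \<ge> 0 \<Longrightarrow> k (r *\<^sub>R s) = r ^ n * k s"
  by (simp add: positively_homogeneous_def)

lemma positively_homogeneous_norm_power:
  "positively_homogeneous (2 * l) (\<lambda>s :: 'v::real_normed_vector. ((norm s)\<^sup>2) ^ l)"
  by (simp add: positively_homogeneous_def power_mult_distrib power_mult)

lemma positively_homogeneous_inner_power: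
  "positively_homogeneous n (\<lambda>s :: 'v::real_inner. (a \<bullet> s) ^ n)"
  by (simp add: positively_homogeneous_def power_mult_distrib)

lemma sum_power_le_power_sum:
  fixes f :: "'i \<Rightarrow> real"
  assumes "finite A" "\<And>x. x \<in> A \<Longrightarrow> f x \<ge> 0"
  shows "(\<Sum>x\<in>A. f x ^ Suc n) \<le> (\<Sum>x\<in>A. f x) ^ Suc n"
proof (induction n)
  case (Suc n)
  have "(\<Sum>x\<in>A. f x ^ Suc (Suc n)) \<le> (\<Sum>x\<in>A. f x ^ Suc n * (\<Sum>x\<in>A. f x))"
    using assms by (intro sum_mono) (auto intro!: mult_right_mono member_le_sum simp: mult.commute)
  also have "\<dots> = (\<Sum>x\<in>A. f x ^ Suc n) * (\<Sum>x\<in>A. f x)" by (simp add: sum_distrib_right)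
  also have "\<dots> \<le> (\<Sum>x\<in>A. f x) ^ Suc n * (\<Sum>x\<in>A. f x)"
    using assms by (intro mult_right_mono Suc.IH sum_nonneg) auto
  finally show ?case by (simp add: mult.commute)
qed simp

context conj_field
begin

lemma continuous_on_kernel:
  "continuous_on UNIV k \<Longrightarrow> continuous_on A (\<lambda>x. k (hinner a x))"
  by (rule continuous_on_compose2[of UNIV k]) (auto intro!: continuous_intros)

lemma kernel_measurable_uniform_sphere:
  assumes "continuous_on UNIV (k :: 'a \<Rightarrow> real)"
  shows "(\<lambda>x. k (hinner a x)) \<in> borel_measurable uniform_sphere"
  using continuous_on_kernel[OF assms] by (intro L2_realD(1) sphere.continuous_on_L2_real)

lemma integral_uniform_sphere_unitary:
  fixes f :: "'a ^ 'n \<Rightarrow> real"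
  assumes "h \<in> unitaries" "f \<in> borel_measurable uniform_sphere"
  shows "(LINT x|uniform_sphere. f (h *v x)) = (LINT x|uniform_sphere. f x)"
  using assms by (intro integral_uniform_sphere_isometry) (auto simp: norm_unitary)

lemma integral_uniform_sphere_homogeneous:
  fixes w e :: "'a ^ 'n" and k :: "'a \<Rightarrow> real"
  assumes k: "continuous_on UNIV k" "positively_homogeneous n k" and e: "norm e = 1"
  shows "(LINT x|uniform_sphere. k (hinner w x)) = norm w ^ n * (LINT x|uniform_sphere. k (hinner e x))"
proof -
  obtain v where v: "norm v = 1" "w = norm w *\<^sub>R v" using unit_directionE[OF e, of w] by metis
  obtain h where h: "h \<in> unitaries" "h *v e = v" using unitaries_transitive[OF e v(1)] by blast
  have "(LINT x|uniform_sphere. k (hinner w x)) =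
      (LINT x|uniform_sphere. norm w ^ n * k (hinner e (adj h *v x)))"
    by (subst v(2)) (simp add: hinner_scaleR_left positively_homogeneousD[OF k(2)] hinner_adj[symmetric] h)
  also have "\<dots> = norm w ^ n * (LINT x|uniform_sphere. k (hinner e x))"
    using integral_uniform_sphere_unitary[OF unitaries_adj[OF h(1)] kernel_measurable_uniform_sphere[OF k(1)]]
    by simp
  finally show ?thesis .
qed

end

context haar_group
begin

lemma integral_haar_homogeneous:
  fixes k :: "'a \<Rightarrow> real" and g :: "'a ^ 'n \<Rightarrow> real"
  assumes k: "continuous_on UNIV k" "positively_homogeneous n k" and g: "g \<in> borel_measurable uniform_sphere"
    and e: "norm e = 1" "norm f = 1" "hinner e f = 0" and v: "hinner v f = 0"
  shows "(LINT R|\<mu>. k (hinner a (R *v v)) * g (R *v f)) =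
    norm v ^ n * (LINT R|\<mu>. k (hinner a (R *v e)) * g (R *v f))"
proof -
  obtain v' where v': "norm v' = 1" "v = norm v *\<^sub>R v'" "hinner f v = 0 \<Longrightarrow> hinner f e = 0 \<Longrightarrow> hinner f v' = 0"
    using unit_directionE[OF e(1), of v] by metis
  then have "hinner v' f = 0" using v e(3) by (simp add: hinner_eq_0_commute[of _ f])
  then have "(LINT R|\<mu>. k (hinner a (R *v v')) * g (R *v f)) = (LINT R|\<mu>. k (hinner a (R *v e)) * g (R *v f))"
    using v'(1) e by (intro integral_haar_pair kernel_measurable_uniform_sphere k(1) g)
  moreover have "k (hinner a (R *v v)) = norm v ^ n * k (hinner a (R *v v'))" for R
    by (subst v'(2))
      (simp add: linear_scale[OF matrix_vector_mul_linear] hinner_scaleR_right positively_homogeneousD[OF k(2)])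
  ultimately show ?thesis by (simp add: mult.assoc)
qed

lemma integrable_haar_sphere_product:
  fixes h g :: "'a ^ 'n \<Rightarrow> real"
  assumes h: "continuous_on UNIV h" and g: "integrable uniform_sphere g" and e: "norm e = 1"
  shows "integrable (\<mu> \<Otimes>\<^sub>M uniform_sphere) (\<lambda>(R, x). h (R *v erase j x) * g (R *v e))"
proof -
  let ?u = "uniform_sphere :: ('a ^ 'n) measure"
  have "bounded (h ` cball 0 1)"
    using continuous_on_subset[OF h] by (intro compact_imp_bounded compact_continuous_image) auto
  then obtain K where K: "\<And>x. norm x \<le> 1 \<Longrightarrow> \<bar>h x\<bar> \<le> K"
    unfolding bounded_iff real_norm_def by (metis image_eqI mem_cball_0)
  have g_int: "integrable \<mu> (\<lambda>R. g (R *v e))" by (rule integrable_haar_orbit[OF e g])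
  then have g_meas: "(\<lambda>p. g (fst p *v e)) \<in> borel_measurable (\<mu> \<Otimes>\<^sub>M ?u)"
    by (intro measurable_compose[OF measurable_fst]) auto
  have "erase j \<in> borel_measurable (borel :: ('a ^ 'n) measure)"
    by (intro borel_measurable_continuous_onI continuous_intros)
  then have "(\<lambda>p. erase j (snd p)) \<in> borel_measurable (\<mu> \<Otimes>\<^sub>M ?u)"
    by (intro measurable_compose[OF measurable_snd] measurable_from_uniform_sphere)
  then have "(\<lambda>p. fst p *v erase j (snd p)) \<in> borel_measurable (\<mu> \<Otimes>\<^sub>M ?u)"
    by (intro borel_measurable_matrix_vector_mult measurable_haar_borel measurable_fst)
  note h_meas = measurable_compose[OF this borel_measurable_continuous_onI[OF h]]
  show ?thesis
  proof (rule Bochner_Integration.integrable_bound)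
    show "integrable (\<mu> \<Otimes>\<^sub>M ?u) (\<lambda>(R, x). K * \<bar>g (R *v e)\<bar>)"
    proof (rule sphere_pair.Fubini_integrable)
      show "(\<lambda>(R, x). K * \<bar>g (R *v e)\<bar>) \<in> borel_measurable (\<mu> \<Otimes>\<^sub>M ?u)"
        using g_meas by (simp add: case_prod_beta')
      show "integrable \<mu> (\<lambda>R. LINT x|?u. norm (case (R, x) of (R, x) \<Rightarrow> K * \<bar>g (R *v e)\<bar>))"
        using g_int by (simp add: sphere.prob_space[simplified] abs_mult)
    qed auto
    show "(\<lambda>(R, x). h (R *v erase j x) * g (R *v e)) \<in> borel_measurable (\<mu> \<Otimes>\<^sub>M ?u)"
      using g_meas h_meas by (simp add: case_prod_beta')
    have "\<bar>h (R *v erase j x)\<bar> \<le> \<bar>K\<bar>" if "R \<in> unitaries" "norm x = 1" for R x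
      using norm_erase_le[of j x] that by (intro order_trans[OF K abs_ge_self]) (simp add: norm_unitary)
    then show "AE p in \<mu> \<Otimes>\<^sub>M ?u. norm (case p of (R, x) \<Rightarrow> h (R *v erase j x) * g (R *v e))
        \<le> norm (case p of (R, x) \<Rightarrow> K * \<bar>g (R *v e)\<bar>)"
      by (intro AE_I2) (auto simp: space_pair_measure abs_mult intro!: mult_right_mono)
  qed
qed

text \<open>
  This determines the conditional expectation of \<open>k (hinner a (R *v axis i 1))\<close> given \<open>R *v axis j 1\<close>.
  By invariance \<open>axis i 1\<close> may be replaced by any unit vector orthogonal to \<open>axis j 1\<close>; instead of
  normalizing, average over \<open>erase j x\<close> with \<open>x\<close> uniform on the sphere.
\<close>

lemma integral_haar_kernel:
  fixes k :: "'a \<Rightarrow> real" and i j :: 'n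
  assumes k: "continuous_on UNIV k" "positively_homogeneous n k" and g: "g \<in> L2_real uniform_sphere"
    and ij: "i \<noteq> j"
  shows "(LINT x|uniform_sphere. norm (erase j x :: 'a ^ 'n) ^ n) *
           (LINT R|\<mu>. k (hinner a (R *v axis i 1)) * g (R *v axis j 1))
       = (LINT x|uniform_sphere. k ((x :: 'a ^ 'n) $ j)) *
           (LINT R|\<mu>. norm (erase j (adj R *v a)) ^ n * g (R *v axis j 1))"
proof -
  let ?u = "uniform_sphere :: ('a ^ 'n) measure"
  have "hinner (axis j 1) (erase j x) = 0" for x :: "'a ^ 'n" by (simp add: erase_def)
  then have orthogonal: "hinner (erase j x) (axis j 1) = 0" for x :: "'a ^ 'n"
    by (simp only: hinner_eq_0_commute[of "erase j x"])
  have axes: "hinner (axis i 1 :: 'a ^ 'n) (axis j 1) = 0"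
    unfolding hinner_axis using ij by (simp add: axis_def)
  have over_R: "(LINT R|\<mu>. k (hinner a (R *v erase j x)) * g (R *v axis j 1)) =
      norm (erase j x) ^ n * (LINT R|\<mu>. k (hinner a (R *v axis i 1)) * g (R *v axis j 1))" for x
    by (rule integral_haar_homogeneous[OF k L2_realD(1)[OF g] _ _ axes orthogonal]) simp_all
  have over_x: "(LINT x|?u. k (hinner a (R *v erase j x))) =
      norm (erase j (adj R *v a)) ^ n * (LINT x|?u. k (x $ j))" for R
  proof -
    have "hinner a (R *v erase j x) = hinner (erase j (adj R *v a)) x" for x
      by (simp add: hinner_erase hinner_adj)
    then show ?thesis
      using integral_uniform_sphere_homogeneous[OF k, of "axis j 1" "erase j (adj R *v a)"] by simp
  qed
  have integrable: "integrable (\<mu> \<Otimes>\<^sub>M ?u) (\<lambda>(R, x). k (hinner a (R *v erase j x)) * g (R *v axis j 1))"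
    by (rule integrable_haar_sphere_product[OF continuous_on_kernel[OF k(1)] sphere.L2_real_integrable[OF g]])
      simp
  have "(LINT x|?u. norm (erase j x) ^ n) * (LINT R|\<mu>. k (hinner a (R *v axis i 1)) * g (R *v axis j 1)) =
      (LINT x|?u. LINT R|\<mu>. k (hinner a (R *v erase j x)) * g (R *v axis j 1))"
    by (simp add: over_R)
  also have "\<dots> = (LINT R|\<mu>. LINT x|?u. k (hinner a (R *v erase j x)) * g (R *v axis j 1))"
    using sphere_pair.Fubini_integral[OF integrable] by simp
  also have "\<dots> = (LINT R|\<mu>. (LINT x|?u. k (x $ j)) *
      (norm (erase j (adj R *v a)) ^ n * g (R *v axis j 1)))"
    by (simp add: over_x mult_ac)
  finally show ?thesis by simp
qed

end

context conj_field
begin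

lemma coordinate_moment_eq:
  fixes i j :: "'n::finite"
  shows "(LINT x|uniform_sphere. ((norm ((x :: 'a ^ 'n) $ i))\<^sup>2) ^ l) =
   (LINT x|uniform_sphere. ((norm ((x :: 'a ^ 'n) $ j))\<^sup>2) ^ l)"
  using integral_uniform_sphere_homogeneous[OF _ positively_homogeneous_norm_power, of l "axis j 1" "axis i 1"]
  by (simp add: continuous_intros)

lemma coordinate_moment_pos: "(LINT x|uniform_sphere. ((norm ((x :: 'a ^ 'n) $ j))\<^sup>2) ^ l) > 0"
  by (rule integral_uniform_sphere_pos[of _ "axis j 1"]) (auto intro!: continuous_intros)

lemma erase_moment_pos:
  fixes i j :: "'n::finite"
  assumes "i \<noteq> j"
  shows "(LINT x|uniform_sphere. norm (erase j (x :: 'a ^ 'n)) ^ n) > 0"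
proof (rule integral_uniform_sphere_pos[of _ "axis i 1"])
  have "(erase j (axis i 1) :: 'a ^ 'n) = axis i 1"
    using assms by (simp add: erase_def axis_def vec_eq_iff)
  then show "norm (erase j (axis i 1 :: 'a ^ 'n)) ^ n > 0" by simp
qed (auto intro!: continuous_intros)

lemma sum_coordinate_moments:
  fixes j :: "'n::finite"
  shows "(LINT x|uniform_sphere. (\<Sum>k\<in>UNIV - {j}. ((norm ((x :: 'a ^ 'n) $ k))\<^sup>2) ^ l)) =
    (real CARD('n) - 1) * (LINT x|uniform_sphere. ((norm ((x :: 'a ^ 'n) $ j))\<^sup>2) ^ l)"
proof -
  have "(LINT x|uniform_sphere. (\<Sum>k\<in>UNIV - {j}. ((norm ((x :: 'a ^ 'n) $ k))\<^sup>2) ^ l)) =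
      (\<Sum>k\<in>UNIV - {j}. LINT x|uniform_sphere. ((norm ((x :: 'a ^ 'n) $ k))\<^sup>2) ^ l)"
    by (intro Bochner_Integration.integral_sum sphere.L2_real_integrable sphere.continuous_on_L2_real
        continuous_intros)
  also have "\<dots> = (\<Sum>k\<in>UNIV - {j}. LINT x|uniform_sphere. ((norm ((x :: 'a ^ 'n) $ j))\<^sup>2) ^ l)"
    by (intro sum.cong refl coordinate_moment_eq)
  finally show ?thesis by (simp add: card_Diff_singleton of_nat_diff Suc_leI)
qed

lemma erase_moment_2:
  fixes j :: "'n::finite"
  shows "(LINT x|uniform_sphere. (norm (erase j (x :: 'a ^ 'n)))\<^sup>2) =
    (real CARD('n) - 1) * (LINT x|uniform_sphere. (norm ((x :: 'a ^ 'n) $ j))\<^sup>2)"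
  using sum_coordinate_moments[of 1 j] by (simp add: norm_erase_sum)

lemma erase_moment_ge:
  fixes j :: "'n::finite"
  shows "(real CARD('n) - 1) * (LINT x|uniform_sphere. ((norm ((x :: 'a ^ 'n) $ j))\<^sup>2) ^ Suc l)
    \<le> (LINT x|uniform_sphere. norm (erase j (x :: 'a ^ 'n)) ^ (2 * Suc l))"
  unfolding sum_coordinate_moments[symmetric]
proof (intro integral_mono sphere.L2_real_integrable sphere.continuous_on_L2_real continuous_intros)
  show "(\<Sum>k\<in>UNIV - {j}. ((norm (x $ k))\<^sup>2) ^ Suc l) \<le> norm (erase j x) ^ (2 * Suc l)" for x :: "'a ^ 'n"
    using sum_power_le_power_sum[of "UNIV - {j}" "\<lambda>k. (norm (x $ k))\<^sup>2" l]
    unfolding power_mult norm_erase_sum by simp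
qed

end

section \<open>The covariance form of two basis vectors\<close>

lemma power_diff_mem_subspace:
  fixes u :: "'a \<Rightarrow> real"
  assumes V: "subspace V" and u: "\<And>p. p < m \<Longrightarrow> (\<lambda>x. u x ^ p) \<in> V"
  shows "(\<lambda>x. (A - u x) ^ m - (- 1) ^ m * u x ^ m) \<in> V"
proof -
  have "(A - u x) ^ m - (- 1) ^ m * u x ^ m =
      (\<Sum>p<m. (real (m choose p) * (- 1) ^ p * A ^ (m - p)) *\<^sub>R (\<lambda>x. u x ^ p)) x" for x
  proof -
    have "(A - u x) ^ m = (\<Sum>p\<le>m. real (m choose p) * (- u x) ^ p * A ^ (m - p))"
      using binomial_ring[of "- u x" A m] by simp
    also have "\<dots> = (\<Sum>p<m. real (m choose p) * (- u x) ^ p * A ^ (m - p)) + (- u x) ^ m"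
      by (simp flip: lessThan_Suc_atMost)
    finally show ?thesis by (simp add: power_minus[of "u x"] mult_ac)
  qed
  then have "(\<lambda>x. (A - u x) ^ m - (- 1) ^ m * u x ^ m) =
      (\<Sum>p<m. (real (m choose p) * (- 1) ^ p * A ^ (m - p)) *\<^sub>R (\<lambda>x. u x ^ p))"
    by (simp add: fun_eq_iff)
  also have "\<dots> \<in> V" using u by (intro subspace_sum[OF V] subspace_scale[OF V]) simp
  finally show ?thesis .
qed

locale haar_basis = haar_group cj \<mu>
  for cj :: "'a::{real_normed_field,euclidean_space} \<Rightarrow> 'a" and \<mu> :: "('a ^ 'n::finite ^ 'n) measure" +
  fixes i j :: 'n
  assumes ij: "i \<noteq> j"
begin

abbreviation "usphere \<equiv> uniform_sphere :: ('a ^ 'n) measure"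

definition pairing :: "('a ^ 'n \<Rightarrow> real) \<Rightarrow> ('a ^ 'n \<Rightarrow> real) \<Rightarrow> real" where
  "pairing f g = (LINT R|\<mu>. f (R *v axis i 1) * g (R *v axis j 1))"

definition sphere_cov :: "('a ^ 'n \<Rightarrow> real) \<Rightarrow> ('a ^ 'n \<Rightarrow> real) \<Rightarrow> real" where
  "sphere_cov f g = L2_inner usphere f g - (LINT x|usphere. f x) * (LINT x|usphere. g x)"

definition basis_cov :: "('a ^ 'n \<Rightarrow> real) \<Rightarrow> ('a ^ 'n \<Rightarrow> real) \<Rightarrow> real" where
  "basis_cov f g = pairing f g - (LINT x|usphere. f x) * (LINT x|usphere. g x)"

lemma card_ge_2: "CARD('n) \<ge> 2"
  using card_mono[of UNIV "{i, j}"] ij by simp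

lemma hinner_axes:
  "hinner (axis i 1 :: 'a ^ 'n) (axis j 1) = 0"
  "hinner (axis j 1 :: 'a ^ 'n) (axis i 1) = 0"
  unfolding hinner_axis using ij by (simp_all add: axis_def)

lemma pairing_eq_L2_inner:
  "pairing f g = L2_inner \<mu> (\<lambda>R. f (R *v axis i 1)) (\<lambda>R. g (R *v axis j 1))"
  by (simp add: pairing_def L2_inner_def)

lemma pairing_commute:
  assumes f: "f \<in> L2_real usphere" and g: "g \<in> L2_real usphere"
  shows "pairing f g = pairing g f"
  unfolding pairing_def
  using integral_haar_pair[OF L2_realD(1)[OF f] L2_realD(1)[OF g] _ _ hinner_axes(1) _ _ hinner_axes(2)]
  by (simp add: mult.commute)

lemma symmetric_form_pairing: "symmetric_form (L2_real usphere) pairing"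
proof
  fix f g h :: "'a ^ 'n \<Rightarrow> real" and c :: real
  assume f: "f \<in> L2_real usphere" and h: "h \<in> L2_real usphere"
  note L2 = L2_haar_orbit[OF norm_axis_1]
  have "(\<lambda>R. (c *\<^sub>R f) (R *v axis i 1)) = c *\<^sub>R (\<lambda>R. f (R *v axis i 1))" by (simp add: fun_eq_iff)
  then show "pairing (c *\<^sub>R f) h = c * pairing f h"
    unfolding pairing_eq_L2_inner using L2.scaleR_left[OF L2[OF f] L2[OF h]] by simp
  assume g: "g \<in> L2_real usphere"
  show "pairing f g = pairing g f" using f g by (rule pairing_commute)
  have "(\<lambda>R. (f + g) (R *v axis i 1)) = (\<lambda>R. f (R *v axis i 1)) + (\<lambda>R. g (R *v axis i 1))"
    by (simp add: fun_eq_iff)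
  then show "pairing (f + g) h = pairing f h + pairing g h"
    unfolding pairing_eq_L2_inner using L2.add_left[OF L2[OF f] L2[OF g] L2[OF h]] by simp
qed (rule subspace_L2_real)

lemma symmetric_form_mean_product:
  "symmetric_form (L2_real usphere) (\<lambda>f g. (LINT x|usphere. f x) * (LINT x|usphere. g x))"
  by (rule symmetric_form_rank_one) (simp_all add: subspace_L2_real sphere.L2_real_integrable)

lemma sphere_cov_self:
  assumes "f \<in> L2_real usphere"
  shows "sphere_cov f f = sphere.variance f"
  unfolding sphere_cov_def L2_inner_def using assms
  by (subst sphere.variance_eq)
    (auto simp: power2_eq_square[symmetric] intro: L2_realD sphere.L2_real_integrable)

sublocale form_pair "L2_real usphere" sphere_cov basis_cov "1 / (real CARD('n) - 1)"
proof (intro form_pair.intro semidefinite_form.intro semidefinite_form_axioms.intro)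
  show "symmetric_form (L2_real usphere) sphere_cov"
    using symmetric_form_linear_combination[OF L2.symmetric_form_axioms symmetric_form_mean_product, of 1 "- 1"]
    by (simp add: sphere_cov_def[abs_def])
  show "symmetric_form (L2_real usphere) basis_cov"
    using symmetric_form_linear_combination[OF symmetric_form_pairing symmetric_form_mean_product, of 1 "- 1"]
    by (simp add: basis_cov_def[abs_def])
  show "sphere_cov f f \<ge> 0" if "f \<in> L2_real usphere" for f
    unfolding sphere_cov_self[OF that] by (rule sphere.variance_positive)
qed

lemma pairing_const: "g \<in> L2_real usphere \<Longrightarrow> pairing (\<lambda>_. c) g = c * (LINT x|usphere. g x)"
  unfolding pairing_def using integral_haar_orbit[of "axis j 1" g] by (simp add: L2_realD)

lemma represents_cov_if_represents_pairing:
  assumes f: "f \<in> L2_real usphere" and h: "h \<in> L2_real usphere"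
    and pairing: "\<And>g. g \<in> L2_real usphere \<Longrightarrow> pairing f g = L2_inner usphere h g"
  shows "represents h f"
proof -
  have "(LINT x|usphere. f x) = (LINT x|usphere. h x)"
    using pairing[of "\<lambda>_. 1"] pairing_commute[OF f] pairing_const[OF f] sphere.L2_real_const[of 1]
    by (simp add: L2_inner_def)
  then show ?thesis using f h pairing by (simp add: represents_def basis_cov_def sphere_cov_def)
qed

lemma represents_const: "represents 0 (\<lambda>_. c)"
  using sphere.prob_space[where 'a = "'a ^ 'n"]
  by (simp add: represents_def carrier_closed sphere.L2_real_const basis_cov_def pairing_const zero_left)

definition axis_ratio :: "('a \<Rightarrow> real) \<Rightarrow> nat \<Rightarrow> real" where
  "axis_ratio k n = (LINT x|usphere. k (x $ j)) / (LINT x|usphere. norm (erase j x) ^ n)"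

lemma represents_even_kernel:
  fixes k :: "'a \<Rightarrow> real"
  assumes k: "continuous_on UNIV k" "positively_homogeneous (2 * l) k"
  shows "represents (axis_ratio k (2 * l) *\<^sub>R (\<lambda>x. ((norm a)\<^sup>2 - (norm (hinner a x))\<^sup>2) ^ l))
    (\<lambda>x. k (hinner a x))"
proof (rule represents_cov_if_represents_pairing)
  let ?h = "\<lambda>x. ((norm a)\<^sup>2 - (norm (hinner a x))\<^sup>2) ^ l"
  have h: "?h \<in> L2_real usphere" by (intro sphere.continuous_on_L2_real continuous_intros)
  then show "axis_ratio k (2 * l) *\<^sub>R ?h \<in> L2_real usphere" by (rule L2.carrier_closed)
  show "(\<lambda>x. k (hinner a x)) \<in> L2_real usphere"
    by (intro sphere.continuous_on_L2_real continuous_on_kernel k)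
  fix g :: "'a ^ 'n \<Rightarrow> real" assume g: "g \<in> L2_real usphere"
  have "(LINT R|\<mu>. norm (erase j (adj R *v a)) ^ (2 * l) * g (R *v axis j 1)) =
      (LINT R|\<mu>. ?h (R *v axis j 1) * g (R *v axis j 1))"
    unfolding power_mult by (intro Bochner_Integration.integral_cong) (auto simp: norm_erase_adj)
  also have "\<dots> = L2_inner usphere ?h g"
    unfolding L2_inner_def using L2_realD(1)[OF h] L2_realD(1)[OF g]
    by (intro integral_haar_orbit) auto
  finally show "pairing (\<lambda>x. k (hinner a x)) g = L2_inner usphere (axis_ratio k (2 * l) *\<^sub>R ?h) g"
    using integral_haar_kernel[OF k g ij, of a] erase_moment_pos[OF ij, of "2 * l"] L2.scaleR_left[OF h g]
    by (simp add: pairing_def axis_ratio_def field_simps)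
qed

lemma represents_odd_kernel:
  fixes k :: "'a \<Rightarrow> real"
  assumes k: "continuous_on UNIV k" "positively_homogeneous n k" and odd: "\<And>s. k (- s) = - k s"
  shows "represents 0 (\<lambda>x. k (hinner a x))"
proof (rule represents_cov_if_represents_pairing)
  show "(\<lambda>x. k (hinner a x)) \<in> L2_real usphere"
    by (intro sphere.continuous_on_L2_real continuous_on_kernel k)
  have "(\<lambda>x :: 'a ^ 'n. k (x $ j)) \<in> borel_measurable usphere"
    using kernel_measurable_uniform_sphere[OF k(1), of "axis j 1"] by simp
  then have "(LINT x|usphere. k (x $ j)) = (LINT x|usphere. k ((- x) $ j))"
    by (rule integral_uniform_sphere_isometry[of uminus, symmetric, rotated 2]) (simp_all add: linear_uminus)
  then have "(LINT x|usphere. k (x $ j)) = 0" by (simp add: odd)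
  then show "pairing (\<lambda>x. k (hinner a x)) g = L2_inner usphere 0 g" if "g \<in> L2_real usphere" for g
    using integral_haar_kernel[OF k that ij, of a] erase_moment_pos[OF ij, of n] L2.zero_left[OF that]
    by (simp add: pairing_def)
qed (rule carrier_closed)

text \<open>
  \<open>modulus_ratio l\<close> is the constant \<open>c\<^sub>l\<close>: for \<open>i \<noteq> j\<close> the coordinate \<open>x $ i\<close> is that of the direction
  of \<open>erase j x\<close> times \<open>norm (erase j x)\<close>, these are independent, and \<open>x $ i\<close> is distributed like \<open>x $ j\<close>.
\<close>

definition modulus_ratio :: "nat \<Rightarrow> real" where
  "modulus_ratio l = axis_ratio (\<lambda>s. ((norm s)\<^sup>2) ^ l) (2 * l)"

lemma modulus_ratio_nonneg: "modulus_ratio l \<ge> 0"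
  using coordinate_moment_pos[of j l] erase_moment_pos[OF ij, of "2 * l"]
  by (simp add: modulus_ratio_def axis_ratio_def)

lemma modulus_ratio_le: "modulus_ratio (Suc l) \<le> 1 / (real CARD('n) - 1)"
  using erase_moment_pos[OF ij, of "2 * Suc l"] erase_moment_ge[of j l] card_ge_2
  by (simp add: modulus_ratio_def axis_ratio_def field_simps)

lemma modulus_ratio_1: "modulus_ratio 1 = 1 / (real CARD('n) - 1)"
  using coordinate_moment_pos[of j 1] by (simp add: modulus_ratio_def axis_ratio_def erase_moment_2)

lemma represents_modulus_power:
  "represents (modulus_ratio l *\<^sub>R (\<lambda>x. ((norm a)\<^sup>2 - (norm (hinner a x))\<^sup>2) ^ l))
    (\<lambda>x. ((norm (hinner a x))\<^sup>2) ^ l)"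
  unfolding modulus_ratio_def
  by (intro represents_even_kernel positively_homogeneous_norm_power continuous_intros)

lemma triangular_modulus_powers:
  assumes "triangular W"
  shows "\<exists>W'. triangular W' \<and> W \<subseteq> W' \<and> (\<forall>l\<le>N. (\<lambda>x. ((norm (hinner a x))\<^sup>2) ^ l) \<in> W')"
proof (induction N)
  case 0
  have "represents (0 *\<^sub>R (\<lambda>_. 1) + 0) (\<lambda>_. 1)" using represents_const[of 1] by simp
  then show ?case
    using triangular_extend[OF assms subspace_0[OF triangular_subspace[OF assms]], of 0 "\<lambda>_. 1"] card_ge_2
    by auto
next
  case (Suc N)
  then obtain V where V: "triangular V" "W \<subseteq> V" "\<And>l. l \<le> N \<Longrightarrow> (\<lambda>x. ((norm (hinner a x))\<^sup>2) ^ l) \<in> V"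
    by blast
  let ?f = "\<lambda>x. ((norm (hinner a x))\<^sup>2) ^ Suc N"
  define c where "c = modulus_ratio (Suc N)"
  define r where "r = c *\<^sub>R (\<lambda>x. ((norm a)\<^sup>2 - (norm (hinner a x))\<^sup>2) ^ Suc N - (- 1) ^ Suc N * ?f x)"
  have "r \<in> V"
    unfolding r_def using triangular_subspace[OF V(1)] V(3)
    by (intro subspace_scale power_diff_mem_subspace) auto
  moreover have "\<bar>c * (- 1) ^ Suc N\<bar> \<le> 1 / (real CARD('n) - 1)"
    using modulus_ratio_nonneg[of "Suc N"] modulus_ratio_le[of N] by (simp add: c_def abs_mult power_abs)
  moreover have "represents ((c * (- 1) ^ Suc N) *\<^sub>R ?f + r) ?f"
  proof -
    have "(c * (- 1) ^ Suc N) *\<^sub>R ?f + r = c *\<^sub>R (\<lambda>x. ((norm a)\<^sup>2 - (norm (hinner a x))\<^sup>2) ^ Suc N)"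
      by (simp add: r_def fun_eq_iff algebra_simps)
    then show ?thesis using represents_modulus_power[of "Suc N" a] by (simp only: c_def)
  qed
  ultimately obtain W' where "triangular W'" "V \<subseteq> W'" "?f \<in> W'"
    using triangular_extend[OF V(1)] by blast
  then show ?case using V by (intro exI[of _ W']) (auto simp: le_Suc_eq)
qed

lemma triangular_linear_power:
  assumes W: "triangular W"
  shows "\<exists>W'. triangular W' \<and> W \<subseteq> W' \<and> (\<lambda>x. (a \<bullet> x) ^ n) \<in> W'"
proof -
  let ?k = "\<lambda>s :: 'a. (1 \<bullet> s) ^ n"
  have k: "continuous_on UNIV ?k" "positively_homogeneous n ?k"
    by (intro continuous_intros, rule positively_homogeneous_inner_power)
  have "\<exists>V r. triangular V \<and> W \<subseteq> V \<and> r \<in> V \<and> represents r (\<lambda>x. ?k (hinner a x))"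
  proof (cases "even n")
    case False
    then have "represents 0 (\<lambda>x. ?k (hinner a x))" by (intro represents_odd_kernel[OF k]) simp
    then show ?thesis using W subspace_0[OF triangular_subspace[OF W]] by blast
  next
    case True
    then obtain m where n: "n = 2 * m" by (elim evenE)
    define u where "u = (\<lambda>x. (norm (hinner a x))\<^sup>2)"
    obtain V where V: "triangular V" "W \<subseteq> V" "\<And>l. l \<le> m \<Longrightarrow> (\<lambda>x. u x ^ l) \<in> V"
      using triangular_modulus_powers[OF W, of m a] by (auto simp: u_def)
    note V_subspace = triangular_subspace[OF V(1)]
    have "(\<lambda>x. ((norm a)\<^sup>2 - u x) ^ m - (- 1) ^ m * u x ^ m) + (- 1) ^ m *\<^sub>R (\<lambda>x. u x ^ m) \<in> V"
      using V(3) by (intro subspace_add subspace_scale power_diff_mem_subspace V_subspace) auto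
    then have "(\<lambda>x. ((norm a)\<^sup>2 - u x) ^ m) \<in> V" by (simp add: plus_fun_def)
    then have "axis_ratio ?k n *\<^sub>R (\<lambda>x. ((norm a)\<^sup>2 - u x) ^ m) \<in> V"
      by (rule subspace_scale[OF V_subspace])
    moreover have "represents (axis_ratio ?k n *\<^sub>R (\<lambda>x. ((norm a)\<^sup>2 - u x) ^ m)) (\<lambda>x. ?k (hinner a x))"
      using k unfolding n u_def by (rule represents_even_kernel)
    ultimately show ?thesis using V(1,2) by blast
  qed
  then obtain V r where V: "triangular V" "W \<subseteq> V" "r \<in> V" and r: "represents r (\<lambda>x. (a \<bullet> x) ^ n)"
    by (auto simp: inner_hinner)
  then show ?thesis
    using triangular_extend[OF V(1,3), of 0 "\<lambda>x. (a \<bullet> x) ^ n"] card_ge_2 by auto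
qed

lemma linear_powers_triangular:
  assumes "p \<in> (linear_powers :: ('a ^ 'n \<Rightarrow> real) set)"
  shows "\<exists>W. triangular W \<and> p \<in> W"
  using assms unfolding linear_powers_def
proof (induction rule: span_induct_alt)
  case base
  then show ?case using triangular.zero by blast
next
  case (step c f p)
  then obtain a n where f: "f = (\<lambda>x. (a \<bullet> x) ^ n)" by auto
  obtain W where W: "triangular W" "p \<in> W" using step.IH by blast
  obtain W' where W': "triangular W'" "W \<subseteq> W'" "f \<in> W'"
    using triangular_linear_power[OF W(1)] unfolding f by blast
  then show ?case
    using W(2) subspace_add subspace_scale triangular_subspace[OF W'(1)] by blast
qed

lemma abs_mean_le_L2_norm:
  assumes "f \<in> L2_real usphere"
  shows "\<bar>LINT x|usphere. f x\<bar> \<le> L2_norm usphere f"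
  using L2.abs_form_le_seminorm[OF assms sphere.L2_real_const[of 1]] sphere.prob_space[where 'a = "'a ^ 'n"]
  by (simp add: L2_inner_def L2_norm_eq)

lemma L2_norm_haar_orbit:
  assumes "f \<in> L2_real usphere"
  shows "L2_norm \<mu> (\<lambda>R. f (R *v axis k 1)) = L2_norm usphere f"
  using integral_haar_orbit[of "axis k 1" "\<lambda>x. (f x)\<^sup>2"] L2_realD(2)[OF assms] by (simp add: L2_norm_eq)

lemma abs_mean_product_le:
  assumes "f \<in> L2_real usphere" "g \<in> L2_real usphere"
  shows "\<bar>(LINT x|usphere. f x) * (LINT x|usphere. g x)\<bar> \<le> L2_norm usphere f * L2_norm usphere g"
  unfolding abs_mult using assms by (intro mult_mono abs_mean_le_L2_norm L2.seminorm_nonneg) auto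

lemma abs_sphere_cov_le:
  assumes "f \<in> L2_real usphere" "g \<in> L2_real usphere"
  shows "\<bar>sphere_cov f g\<bar> \<le> 2 * (L2_norm usphere f * L2_norm usphere g)"
  unfolding sphere_cov_def using abs_mean_product_le[OF assms] L2.abs_form_le_seminorm[OF assms] by linarith

lemma abs_basis_cov_le:
  assumes "f \<in> L2_real usphere" "g \<in> L2_real usphere"
  shows "\<bar>basis_cov f g\<bar> \<le> 2 * (L2_norm usphere f * L2_norm usphere g)"
proof -
  have "\<bar>pairing f g\<bar> \<le> L2_norm usphere f * L2_norm usphere g"
    using L2.abs_form_le_seminorm[OF assms[THEN L2_haar_orbit[OF norm_axis_1]]]
    by (simp add: pairing_eq_L2_inner L2_norm_haar_orbit assms)
  then show ?thesis unfolding basis_cov_def using abs_mean_product_le[OF assms] by linarith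
qed

theorem abs_basis_cov_le_variance:
  assumes f: "f \<in> L2_real usphere"
  shows "\<bar>basis_cov f f\<bar> \<le> 1 / (real CARD('n) - 1) * sphere.variance f"
proof -
  define \<kappa> where "\<kappa> = 1 / (real CARD('n) - 1)"
  have "\<kappa> \<ge> 0" using card_ge_2 by (simp add: \<kappa>_def)
  have "\<kappa> * sphere_cov f f + s * basis_cov f f \<ge> 0" if s: "\<bar>s\<bar> = 1" for s
  proof (rule L2.nonneg_on_form_closure[where D = "\<lambda>f g. \<kappa> * sphere_cov f g + s * basis_cov f g"])
    show "symmetric_form (L2_real usphere) (\<lambda>f g. \<kappa> * sphere_cov f g + s * basis_cov f g)"
      by (rule symmetric_form_linear_combination[OF symmetric_form_axioms B.symmetric_form_axioms])
    show "\<bar>\<kappa> * sphere_cov f g + s * basis_cov f g\<bar> \<le> (2 * \<kappa> + 2) * (L2_norm usphere f * L2_norm usphere g)"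
      if fg: "f \<in> L2_real usphere" "g \<in> L2_real usphere" for f g
    proof -
      have "\<bar>\<kappa> * sphere_cov f g + s * basis_cov f g\<bar> \<le> \<kappa> * \<bar>sphere_cov f g\<bar> + \<bar>basis_cov f g\<bar>"
        using abs_triangle_ineq[of "\<kappa> * sphere_cov f g" "s * basis_cov f g"] s \<open>\<kappa> \<ge> 0\<close>
        by (simp add: abs_mult)
      also have "\<dots> \<le> \<kappa> * (2 * (L2_norm usphere f * L2_norm usphere g))
          + 2 * (L2_norm usphere f * L2_norm usphere g)"
        using \<open>\<kappa> \<ge> 0\<close> by (intro add_mono mult_left_mono abs_sphere_cov_le abs_basis_cov_le fg)
      finally show ?thesis by (simp add: algebra_simps)
    qed
    show "linear_powers \<subseteq> L2_real usphere" by (rule sphere.linear_powers_L2)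
    show "\<kappa> * sphere_cov p p + s * basis_cov p p \<ge> 0" if "p \<in> linear_powers" for p
    proof -
      have "\<bar>s * basis_cov p p\<bar> \<le> \<kappa> * sphere_cov p p"
        using linear_powers_triangular[OF that] triangular_bound s by (auto simp: abs_mult \<kappa>_def)
      then show ?thesis by linarith
    qed
    show "f \<in> L2_closure usphere linear_powers" using f by (simp add: sphere.linear_powers_dense_L2)
  qed
  from this[of 1] this[of "- 1"] show ?thesis
    by (simp add: \<kappa>_def sphere_cov_self[OF f])
qed

lemma basis_cov_coordinate:
  "basis_cov (\<lambda>x. (norm (x $ j))\<^sup>2) (\<lambda>x. (norm (x $ j))\<^sup>2) =
    - (1 / (real CARD('n) - 1) * sphere.variance (\<lambda>x :: 'a ^ 'n. (norm (x $ j))\<^sup>2))"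
proof -
  let ?f = "\<lambda>x :: 'a ^ 'n. (norm (x $ j))\<^sup>2"
  define \<kappa> where "\<kappa> = 1 / (real CARD('n) - 1)"
  have f: "?f \<in> L2_real usphere" by (intro sphere.continuous_on_L2_real continuous_intros)
  have const: "(\<lambda>_. \<kappa>) \<in> L2_real usphere" by (rule sphere.L2_real_const)
  have "represents (\<kappa> *\<^sub>R (\<lambda>x. 1 - ?f x)) ?f"
    using represents_modulus_power[of 1 "axis j 1"] modulus_ratio_1 by (simp add: \<kappa>_def)
  moreover have "\<kappa> *\<^sub>R (\<lambda>x. 1 - ?f x) = (\<lambda>_. \<kappa>) - \<kappa> *\<^sub>R ?f"
    by (simp add: fun_eq_iff algebra_simps)
  ultimately have "basis_cov ?f ?f = sphere_cov (\<lambda>_. \<kappa>) ?f - \<kappa> * sphere_cov ?f ?f"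
    using f const by (simp add: representsD(3) diff_left scaleR_left carrier_closed)
  also have "sphere_cov (\<lambda>_. \<kappa>) ?f = 0"
    using sphere.prob_space[where 'a = "'a ^ 'n"] by (simp add: sphere_cov_def L2_inner_def)
  finally show ?thesis by (simp add: \<kappa>_def sphere_cov_self[OF f])
qed

end

section \<open>Covariance of two vectors of a uniform random orthonormal basis\<close>

lemma (in conj_field) onb_component_measurable:
  "(\<lambda>b. b $ k) \<in> onb_space (hinner :: 'a ^ 'n \<Rightarrow> _) \<rightarrow>\<^sub>M uniform_sphere"
proof (rule measurable_uniform_sphereI)
  have "(\<lambda>b :: 'a ^ 'n ^ 'n. b $ k) \<in> borel_measurable borel"
    by (intro borel_measurable_continuous_onI continuous_intros)
  then show "(\<lambda>b. b $ k) \<in> borel_measurable (onb_space (hinner :: 'a ^ 'n \<Rightarrow> _))"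
    unfolding onb_space_def by (rule measurable_restrict_space1)
  show "norm (b $ k) = 1" if "b \<in> space (onb_space hinner)" for b :: "'a ^ 'n ^ 'n"
    using that by (simp add: norm_eq_1_iff_hinner onb_space_def space_restrict_space onb_def)
qed

lemma (in haar_group) columns_measurable:
  "(\<lambda>R. \<chi> i. R *v axis i 1) \<in> \<mu> \<rightarrow>\<^sub>M onb_space (hinner :: 'a ^ 'n \<Rightarrow> _)"
  unfolding onb_space_def
proof (rule measurable_restrict_space2)
  show "(\<lambda>R. \<chi> i. R *v axis i 1) \<in> space \<mu> \<rightarrow> onb (hinner :: 'a ^ 'n \<Rightarrow> _)"
    by (auto simp: onb_def hinner_unitary) (simp_all add: axis_def)
  have "(\<lambda>R :: 'a ^ 'n ^ 'n. \<chi> i. R *v axis i 1) \<in> borel_measurable borel"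
    unfolding matrix_vector_mult_def by (intro borel_measurable_continuous_onI continuous_intros)
  then show "(\<lambda>R. \<chi> i. R *v axis i 1) \<in> borel_measurable \<mu>" by (rule measurable_from_haar)
qed

lemma (in haar_basis) covariance_uniform_onb:
  assumes b: "b \<in> M \<rightarrow>\<^sub>M onb_space hinner"
    and law: "distr M (onb_space hinner) b = distr \<mu> (onb_space hinner) (\<lambda>R. \<chi> i. R *v axis i 1)"
    and \<phi>: "\<phi> \<in> L2_real usphere"
  shows "covariance M (\<lambda>\<omega>. \<phi> (b \<omega> $ i)) (\<lambda>\<omega>. \<phi> (b \<omega> $ j)) = basis_cov \<phi> \<phi>"
proof -
  have transfer: "(LINT \<omega>|M. F (b \<omega>)) = (LINT R|\<mu>. F (\<chi> i. R *v axis i 1))"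
    if F: "F \<in> borel_measurable (onb_space hinner)" for F :: "'a ^ 'n ^ 'n \<Rightarrow> real"
    using integral_distr[OF b F] integral_distr[OF columns_measurable F] law by simp
  have comp: "(\<lambda>b. \<phi> (b $ k)) \<in> borel_measurable (onb_space hinner)" for k
    by (rule measurable_compose[OF onb_component_measurable L2_realD(1)[OF \<phi>]])
  let ?m = "LINT x|usphere. \<phi> x"
  have mean: "(LINT R|\<mu>. \<phi> (R *v axis k 1)) = ?m" for k
    by (rule integral_haar_orbit[OF norm_axis_1 L2_realD(1)[OF \<phi>]])
  have int: "integrable \<mu> (\<lambda>R. \<phi> (R *v axis k 1))" for k
    by (rule integrable_haar_orbit[OF norm_axis_1 sphere.L2_real_integrable[OF \<phi>]])
  have int_prod: "integrable \<mu> (\<lambda>R. \<phi> (R *v axis i 1) * \<phi> (R *v axis j 1))"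
    by (intro L2_real_mult_integrable L2_haar_orbit norm_axis_1 \<phi>)
  have "covariance M (\<lambda>\<omega>. \<phi> (b \<omega> $ i)) (\<lambda>\<omega>. \<phi> (b \<omega> $ j)) =
      (LINT \<omega>|M. (\<phi> (b \<omega> $ i) - ?m) * (\<phi> (b \<omega> $ j) - ?m))"
    using transfer[OF comp] by (simp add: covariance_def mean)
  also have "\<dots> = (LINT R|\<mu>. (\<phi> (R *v axis i 1) - ?m) * (\<phi> (R *v axis j 1) - ?m))"
    using comp[of i] comp[of j]
    by (subst transfer[of "\<lambda>b. (\<phi> (b $ i) - ?m) * (\<phi> (b $ j) - ?m)"]) auto
  also have "\<dots> = (LINT R|\<mu>. \<phi> (R *v axis i 1) * \<phi> (R *v axis j 1) - ?m * \<phi> (R *v axis i 1)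
      - ?m * \<phi> (R *v axis j 1) + ?m\<^sup>2)"
    by (simp add: algebra_simps power2_eq_square)
  also have "\<dots> = pairing \<phi> \<phi> - ?m * ?m"
    using int int_prod prob_space by (simp add: mean pairing_def power2_eq_square)
  finally show ?thesis by (simp add: basis_cov_def)
qed

context conj_field
begin

lemma uniform_random_onbE:
  fixes i j :: "'n::finite"
  assumes "i \<noteq> j" "uniform_random_onb (hinner :: 'a ^ 'n \<Rightarrow> _) unitaries M b"
  obtains \<mu> where "haar_basis cj \<mu> i j" "b \<in> M \<rightarrow>\<^sub>M onb_space hinner"
    "distr M (onb_space hinner) b = distr \<mu> (onb_space hinner) (\<lambda>R. \<chi> i. R *v axis i 1)"
proof -
  obtain \<mu> where \<mu>: "normalized_haar (unitaries :: ('a ^ 'n ^ 'n) set) \<mu>"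
    and b: "b \<in> M \<rightarrow>\<^sub>M onb_space hinner"
      "distr M (onb_space hinner) b = distr \<mu> (onb_space hinner) (\<lambda>R. \<chi> i. R *v axis i 1)"
    using assms(2) by (auto simp: uniform_random_onb_def)
  have "haar_basis cj \<mu> i j" by unfold_locales (rule \<mu>, rule assms(1))
  then show thesis using b by (rule that)
qed

lemma abs_covariance_uniform_onb_le:
  fixes i j :: "'n::finite"
  assumes ij: "i \<noteq> j" and b: "uniform_random_onb (hinner :: 'a ^ 'n \<Rightarrow> _) unitaries M b"
    and \<phi>: "\<phi> \<in> L2_real uniform_sphere"
  shows "\<bar>covariance M (\<lambda>\<omega>. \<phi> (b \<omega> $ i)) (\<lambda>\<omega>. \<phi> (b \<omega> $ j))\<bar>
    \<le> 1 / (real CARD('n) - 1) * sphere.variance \<phi>"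
proof -
  obtain \<mu> where \<mu>: "haar_basis cj \<mu> i j" and law: "b \<in> M \<rightarrow>\<^sub>M onb_space hinner"
    "distr M (onb_space hinner) b = distr \<mu> (onb_space hinner) (\<lambda>R. \<chi> i. R *v axis i 1)"
    using ij b by (rule uniform_random_onbE)
  interpret haar_basis cj \<mu> i j by (rule \<mu>)
  show ?thesis
    unfolding covariance_uniform_onb[OF law \<phi>] by (rule abs_basis_cov_le_variance[OF \<phi>])
qed

lemma abs_covariance_uniform_onb_coordinate:
  fixes i j :: "'n::finite"
  assumes ij: "i \<noteq> j" and b: "uniform_random_onb (hinner :: 'a ^ 'n \<Rightarrow> _) unitaries M b"
  shows "\<bar>covariance M (\<lambda>\<omega>. (norm (b \<omega> $ i $ j))\<^sup>2) (\<lambda>\<omega>. (norm (b \<omega> $ j $ j))\<^sup>2)\<bar>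
    = 1 / (real CARD('n) - 1) * sphere.variance (\<lambda>x :: 'a ^ 'n. (norm (x $ j))\<^sup>2)"
proof -
  let ?f = "\<lambda>x :: 'a ^ 'n. (norm (x $ j))\<^sup>2"
  obtain \<mu> where \<mu>: "haar_basis cj \<mu> i j" and law: "b \<in> M \<rightarrow>\<^sub>M onb_space hinner"
    "distr M (onb_space hinner) b = distr \<mu> (onb_space hinner) (\<lambda>R. \<chi> i. R *v axis i 1)"
    using ij b by (rule uniform_random_onbE)
  interpret haar_basis cj \<mu> i j by (rule \<mu>)
  have "?f \<in> L2_real usphere" by (intro sphere.continuous_on_L2_real continuous_intros)
  from covariance_uniform_onb[OF law this]
  have "covariance M (\<lambda>\<omega>. ?f (b \<omega> $ i)) (\<lambda>\<omega>. ?f (b \<omega> $ j)) =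
      - (1 / (real CARD('n) - 1) * sphere.variance ?f)"
    by (simp only: basis_cov_coordinate)
  moreover have "0 \<le> 1 / (real CARD('n) - 1) * sphere.variance ?f"
    using card_ge_2 sphere.variance_positive[of ?f] by (intro mult_nonneg_nonneg) auto
  ultimately show ?thesis by simp
qed

lemma covariance_uniform_onb_sharp:
  fixes i j :: "'n::finite"
  assumes ij: "i \<noteq> j"
  shows "\<exists>\<phi> \<in> L2_real (uniform_sphere :: ('a ^ 'n) measure). sphere.variance \<phi> > 0 \<and>
    (\<forall>(M :: 'w measure) b. uniform_random_onb (hinner :: 'a ^ 'n \<Rightarrow> _) unitaries M b \<longrightarrow>
       \<bar>covariance M (\<lambda>\<omega>. \<phi> (b \<omega> $ i)) (\<lambda>\<omega>. \<phi> (b \<omega> $ j))\<bar>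
         = 1 / (real CARD('n) - 1) * sphere.variance \<phi>)"
proof (intro bexI conjI allI impI)
  let ?f = "\<lambda>x :: 'a ^ 'n. (norm (x $ j))\<^sup>2"
  show "?f \<in> L2_real uniform_sphere"
    by (intro sphere.continuous_on_L2_real continuous_intros)
  have "axis i 1 $ j = (0 :: 'a)" "axis j 1 $ j = (1 :: 'a)" using ij by (simp_all add: axis_def)
  then show "sphere.variance ?f > 0"
    by (intro variance_uniform_sphere_pos[of _ "axis i 1" "axis j 1"]) (auto intro!: continuous_intros)
qed (rule abs_covariance_uniform_onb_coordinate[OF ij])

end

theorem theorem2:
  fixes i j :: "'n::finite"
  assumes "CARD('n) \<ge> 4" and "i \<noteq> j"
  shows
    "(\<forall>(M :: 'w measure) (b :: 'w \<Rightarrow> real ^ 'n ^ 'n) \<phi>.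
        uniform_random_onb inner orthogonal_group M b \<and> \<phi> \<in> L2_real uniform_sphere \<longrightarrow>
        \<bar>covariance M (\<lambda>\<omega>. \<phi> (b \<omega> $ i)) (\<lambda>\<omega>. \<phi> (b \<omega> $ j))\<bar>
          \<le> 1 / (real CARD('n) - 1) * prob_space.variance uniform_sphere \<phi>)
     \<and> (\<exists>\<phi> \<in> L2_real (uniform_sphere :: (real ^ 'n) measure).
        prob_space.variance uniform_sphere \<phi> > 0 \<and>
        (\<forall>(M :: 'w measure) (b :: 'w \<Rightarrow> real ^ 'n ^ 'n).
           uniform_random_onb inner orthogonal_group M b \<longrightarrow>
           \<bar>covariance M (\<lambda>\<omega>. \<phi> (b \<omega> $ i)) (\<lambda>\<omega>. \<phi> (b \<omega> $ j))\<bar>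
             = 1 / (real CARD('n) - 1) * prob_space.variance uniform_sphere \<phi>))
     \<and> (\<forall>(M :: 'w measure) (b :: 'w \<Rightarrow> complex ^ 'n ^ 'n) \<phi>.
        uniform_random_onb cinner_vec unitary_group M b \<and> \<phi> \<in> L2_real uniform_sphere \<longrightarrow>
        \<bar>covariance M (\<lambda>\<omega>. \<phi> (b \<omega> $ i)) (\<lambda>\<omega>. \<phi> (b \<omega> $ j))\<bar>
          \<le> 1 / (real CARD('n) - 1) * prob_space.variance uniform_sphere \<phi>)
     \<and> (\<exists>\<phi> \<in> L2_real (uniform_sphere :: (complex ^ 'n) measure).
        prob_space.variance uniform_sphere \<phi> > 0 \<and>
        (\<forall>(M :: 'w measure) (b :: 'w \<Rightarrow> complex ^ 'n ^ 'n).
           uniform_random_onb cinner_vec unitary_group M b \<longrightarrow>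
           \<bar>covariance M (\<lambda>\<omega>. \<phi> (b \<omega> $ i)) (\<lambda>\<omega>. \<phi> (b \<omega> $ j))\<bar>
             = 1 / (real CARD('n) - 1) * prob_space.variance uniform_sphere \<phi>))"
proof (intro conjI)
  show "\<forall>(M :: 'w measure) (b :: 'w \<Rightarrow> real ^ 'n ^ 'n) \<phi>.
        uniform_random_onb inner orthogonal_group M b \<and> \<phi> \<in> L2_real uniform_sphere \<longrightarrow>
        \<bar>covariance M (\<lambda>\<omega>. \<phi> (b \<omega> $ i)) (\<lambda>\<omega>. \<phi> (b \<omega> $ j))\<bar>
          \<le> 1 / (real CARD('n) - 1) * prob_space.variance uniform_sphere \<phi>"
    using conj_field.abs_covariance_uniform_onb_le[OF conj_field_real assms(2)]
    unfolding hinner_real unitaries_real by blast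
  show "\<forall>(M :: 'w measure) (b :: 'w \<Rightarrow> complex ^ 'n ^ 'n) \<phi>.
        uniform_random_onb cinner_vec unitary_group M b \<and> \<phi> \<in> L2_real uniform_sphere \<longrightarrow>
        \<bar>covariance M (\<lambda>\<omega>. \<phi> (b \<omega> $ i)) (\<lambda>\<omega>. \<phi> (b \<omega> $ j))\<bar>
          \<le> 1 / (real CARD('n) - 1) * prob_space.variance uniform_sphere \<phi>"
    using conj_field.abs_covariance_uniform_onb_le[OF conj_field_cnj assms(2)]
    unfolding hinner_cnj unitaries_cnj by blast
qed (use conj_field.covariance_uniform_onb_sharp[OF conj_field_real assms(2)]
      conj_field.covariance_uniform_onb_sharp[OF conj_field_cnj assms(2)]
    in \<open>simp_all only: hinner_real unitaries_real hinner_cnj unitaries_cnj\<close>)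

end
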